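(* Let $T>1$ and $N\ge 1$ be integers, let $\rho_i:\mathbb R\to\mathbb R^+$ and $\phi_i:\mathbb R^N\to\mathbb R^N$ ($i=1,2,3,4$), and let $F,G,H:\mathbb Z\times\mathbb R^N\times\mathbb R^N\to\mathbb R$. Assume: ($\rho$) each $\rho_i$ is $T$-periodic and $\min_{t\in\mathbb Z[1,T]}\rho_i(t)>0$, $i=1,2,3,4$; (A1) each $\phi_i$ is a homeomorphism of $\mathbb R^N$ onto $\mathbb R^N$ with $\phi_i(0)=0$ and $\phi_i=\nabla\Phi_i$, where $\Phi_i\in C^1(\mathbb R^N,[0,+\infty))$ is strictly convex and $\Phi_i(0)=0$, $i=1,2,3,4$; (A2) $F,G,H$ are $T$-periodic in $t$ for all $(x_1,x_2)\in\mathbb R^N\times\mathbb R^N$ and continuously differentiable in $(x_1,x_2)$ for every $t\in\mathbb Z[1,T]$; for $\lambda,\nu\in\mathbb R$ put $W(t,x_1,x_2)=F(t,x_1,x_2)-\lambda G(t,x_1,x_2)+\nu H(t,x_1,x_2)$; (A3) there exist positive constants $c_i$ ($i=1,2,3,4$) and $\theta>1$ such that $(\phi_i(x)-\phi_i(y),x-y)\ge c_i|x-y|^\theta$ for all $x,y\in\mathbb R^N$, $i=1,2,3,4$; (A4) $\lim_{|x|\to\infty}\Phi_i(x)=+\infty$ and there exist positive constants $l\ge\theta$, $d_i$ and $m_i$ such that $\Phi_i(x)\le d_i|x|^l+m_i$ for all $x\in\mathbb R^N$, $i=1,2,3,4$; (A5) for all $t\in\mathbb Z[1,T]$, $$\lim_{|x_1|+|x_2|\to\infty}\frac{F(t,x_1,x_2)}{|x_1|^l+|x_2|^l}=+\infty,$$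 and for all $t\in\mathbb Z[1,T]$ and all $\lambda>0$ there exists $C_0(\lambda)\in\mathbb R$ such that $\lambda G(t,x_1,x_2)\ge F(t,x_1,x_2)+C_0(\lambda)$ for all $(x_1,x_2)\in\mathbb R^N\times\mathbb R^N$; (A6) $\sum_{t=1}^TG(t,0,0)=0$. Let $E$, $\|\cdot\|$, $I,\Psi,\Phi$, $\mu^*(I,\Psi,\Phi,r)$ and $\beta(\mu I+\Psi,\Phi,r)$ be as defined in the context. Then for each $r>0$, for each $\mu>\max\{0,\mu^*(I,\Psi,\Phi,r)\}$, and for each compact interval $[a,b]\subset\,]0,\beta(\mu I+\Psi,\Phi,r)[$, there exists a number $\rho>0$ with the following property: for every $\lambda\in[a,b]$ there exists $\delta>0$ such that, for each $\nu\in[0,\delta]$, the system $$\begin{cases}\mu\Delta\big[\rho_1(t-1)\phi_1(\Delta u_1(t-1))\big]-\mu\rho_3(t)\phi_3(u_1(t))+\nabla_{u_1}W(t,u_1(t),u_2(t))=0\\ \mu\Delta\big[\rho_2(t-1)\phi_2(\Delta u_2(t-1))\big]-\mu\rho_4(t)\phi_4(u_2(t))+\nabla_{u_2}W(t,u_1(t),u_2(t))=0\end{cases}\qquad(t\in\mathbb Z)$$ has at least three $T$-periodic solutions $u=(u_1,u_2)\in E$ whose norms $\|u\|$ are less than $\rho$.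
   Context: Notation: $\mathbb Z[a,b]=\{a,a+1,\dots,b\}$ for integers $a<b$; $\Delta u(t)=u(t+1)-u(t)$ is the forward difference; $(\cdot,\cdot)$ and $|\cdot|$ are the usual inner product and norm on $\mathbb R^N$; $]c,d[$ denotes an open interval. Space: $E_T=\{h=\{h(t)\}_{t\in\mathbb Z}: h(t)\in\mathbb R^N,\ h(t+T)=h(t)\ \forall t\in\mathbb Z\}$ with norm $\|h\|_{E_T}=\big(\sum_{t=1}^T|\Delta h(t)|^\theta+\sum_{t=1}^T|h(t)|^\theta\big)^{1/\theta}$, where $\theta$ is the constant of (A3); $E=E_T\times E_T$ with norm $\|u\|=\|u_1\|_{E_T}+\|u_2\|_{E_T}$ for $u=(u_1,u_2)$. Functionals on $E$: $$I(u)=\sum_{t=1}^T\big[\rho_1(t)\Phi_1(\Delta u_1(t))+\rho_2(t)\Phi_2(\Delta u_2(t))+\rho_3(t)\Phi_3(u_1(t))+\rho_4(t)\Phi_4(u_2(t))\big],$$ $$\Psi(u)=-\sum_{t=1}^TF(t,u_1(t),u_2(t)),\qquad \Phi(u)=\sum_{t=1}^TG(t,u_1(t),u_2(t)).$$ For $r>0$: $$\gamma=\inf_{u\in E}(\Psi(u)+\Phi(u)),\qquad \eta_r=\inf_{u\in\Phi^{-1}(r)}I(u),$$ $$\mu^*(I,\Psi,\Phi,r)=\inf\Big\{\frac{\Psi(u)-\gamma+r}{\eta_r-I(u)}:\ u\in E,\ \Phi(u)<r,\ I(u)<\eta_r\Big\},$$ $$\beta(\mu I+\Psi,\Phi,r)=\sup_{u\in\Phi^{-1}(]r,+\infty[)}\frac{\mu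 I(u)+\Psi(u)-\inf_{\Phi^{-1}(]-\infty,r])}(\mu I+\Psi)}{r-\Phi(u)}.$$ *)

theory Defs
  imports "HOL-Analysis.Analysis"
begin

definition gradient :: "('a::real_inner \<Rightarrow> real) \<Rightarrow> 'a \<Rightarrow> 'a"
  where "gradient f x = (THE D. GDERIV f x :> D)"

definition C1 :: "('a::real_inner \<Rightarrow> real) \<Rightarrow> bool"
  where "C1 f \<longleftrightarrow> (\<exists>g. (\<forall>x. GDERIV f x :> g x) \<and> continuous_on UNIV g)"

definition strictly_convex :: "('a::real_vector \<Rightarrow> real) \<Rightarrow> bool"
  where "strictly_convex f \<longleftrightarrow>
    (\<forall>x y s. x \<noteq> y \<and> 0 < s \<and> s < 1 \<longrightarrow>
      f ((1 - s) *\<^sub>R x + s *\<^sub>R y) < (1 - s) * f x + s * f y)"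

definition fdiff :: "(int \<Rightarrow> 'a::ab_group_add) \<Rightarrow> int \<Rightarrow> 'a" (\<open>\<Delta>\<close>)
  where "\<Delta> u t = u (t + 1) - u t"

(* The spaces of T-periodic sequences and of pairs of such sequences are carrier sets inside
   function types; their norms are plain functions, not class instances. *)

definition E_per :: "int \<Rightarrow> (int \<Rightarrow> real ^ 'n) set"
  where "E_per T = {h. \<forall>t. h (t + T) = h t}"

definition norm_per :: "int \<Rightarrow> real \<Rightarrow> (int \<Rightarrow> real ^ 'n) \<Rightarrow> real"
  where "norm_per T \<theta> h =
    ((\<Sum>t\<in>{1..T}. norm (\<Delta> h t) powr \<theta>) + (\<Sum>t\<in>{1..T}. norm (h t) powr \<theta>)) powr (1 / \<theta>)"

definition E_pair :: "int \<Rightarrow> ((int \<Rightarrow> real ^ 'n) \<times> (int \<Rightarrow> real ^ 'n)) set"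
  where "E_pair T = E_per T \<times> E_per T"

definition norm_pair ::
    "int \<Rightarrow> real \<Rightarrow> (int \<Rightarrow> real ^ 'n) \<times> (int \<Rightarrow> real ^ 'n) \<Rightarrow> real"
  where "norm_pair T \<theta> u = norm_per T \<theta> (fst u) + norm_per T \<theta> (snd u)"

definition I_fun :: "int \<Rightarrow> (nat \<Rightarrow> real \<Rightarrow> real) \<Rightarrow> (nat \<Rightarrow> real ^ 'n \<Rightarrow> real) \<Rightarrow>
    (int \<Rightarrow> real ^ 'n) \<times> (int \<Rightarrow> real ^ 'n) \<Rightarrow> real"
  where "I_fun T \<rho> \<Phi> u = (\<Sum>t\<in>{1..T}.
      \<rho> 1 (real_of_int t) * \<Phi> 1 (\<Delta> (fst u) t) + \<rho> 2 (real_of_int t) * \<Phi> 2 (\<Delta> (snd u) t)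
    + \<rho> 3 (real_of_int t) * \<Phi> 3 (fst u t) + \<rho> 4 (real_of_int t) * \<Phi> 4 (snd u t))"

definition Psi_fun :: "int \<Rightarrow> (int \<Rightarrow> real ^ 'n \<Rightarrow> real ^ 'n \<Rightarrow> real) \<Rightarrow>
    (int \<Rightarrow> real ^ 'n) \<times> (int \<Rightarrow> real ^ 'n) \<Rightarrow> real"
  where "Psi_fun T F u = - (\<Sum>t\<in>{1..T}. F t (fst u t) (snd u t))"

definition Phi_fun :: "int \<Rightarrow> (int \<Rightarrow> real ^ 'n \<Rightarrow> real ^ 'n \<Rightarrow> real) \<Rightarrow>
    (int \<Rightarrow> real ^ 'n) \<times> (int \<Rightarrow> real ^ 'n) \<Rightarrow> real"
  where "Phi_fun T G u = (\<Sum>t\<in>{1..T}. G t (fst u t) (snd u t))"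

(* All infima and suprema below are taken in the extended reals, so that unbounded or empty
   families get their usual values. X is the space on which the functionals are considered. *)

definition gamma_inf :: "'a set \<Rightarrow> ('a \<Rightarrow> real) \<Rightarrow> ('a \<Rightarrow> real) \<Rightarrow> ereal"
  where "gamma_inf X Psi Phi = (INF u\<in>X. ereal (Psi u + Phi u))"

definition eta :: "'a set \<Rightarrow> ('a \<Rightarrow> real) \<Rightarrow> ('a \<Rightarrow> real) \<Rightarrow> real \<Rightarrow> ereal"
  where "eta X I Phi r = (INF u\<in>{u\<in>X. Phi u = r}. ereal (I u))"

definition mu_star ::
    "'a set \<Rightarrow> ('a \<Rightarrow> real) \<Rightarrow> ('a \<Rightarrow> real) \<Rightarrow> ('a \<Rightarrow> real) \<Rightarrow> real \<Rightarrow> ereal"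
  where "mu_star X I Psi Phi r =
    (INF u\<in>{u\<in>X. Phi u < r \<and> ereal (I u) < eta X I Phi r}.
      (ereal (Psi u) - gamma_inf X Psi Phi + ereal r) / (eta X I Phi r - ereal (I u)))"

definition beta_sup :: "'a set \<Rightarrow> ('a \<Rightarrow> real) \<Rightarrow> ('a \<Rightarrow> real) \<Rightarrow> real \<Rightarrow> ereal"
  where "beta_sup X J Phi r =
    (SUP u\<in>{u\<in>X. Phi u > r}.
      (ereal (J u) - (INF v\<in>{v\<in>X. Phi v \<le> r}. ereal (J v))) / ereal (r - Phi u))"

definition W_fun :: "(int \<Rightarrow> 'a \<Rightarrow> 'a \<Rightarrow> real) \<Rightarrow> (int \<Rightarrow> 'a \<Rightarrow> 'a \<Rightarrow> real) \<Rightarrow>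
    (int \<Rightarrow> 'a \<Rightarrow> 'a \<Rightarrow> real) \<Rightarrow> real \<Rightarrow> real \<Rightarrow> int \<Rightarrow> 'a \<Rightarrow> 'a \<Rightarrow> real"
  where "W_fun F G H lam nu t x1 x2 = F t x1 x2 - lam * G t x1 x2 + nu * H t x1 x2"

definition solves_system :: "(nat \<Rightarrow> real \<Rightarrow> real) \<Rightarrow> (nat \<Rightarrow> real ^ 'n \<Rightarrow> real ^ 'n) \<Rightarrow>
    (int \<Rightarrow> real ^ 'n \<Rightarrow> real ^ 'n \<Rightarrow> real) \<Rightarrow> real \<Rightarrow>
    (int \<Rightarrow> real ^ 'n) \<times> (int \<Rightarrow> real ^ 'n) \<Rightarrow> bool"
  where "solves_system \<rho> \<phi> W \<mu> u \<longleftrightarrow> (\<forall>t.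
      \<mu> *\<^sub>R \<Delta> (\<lambda>s. \<rho> 1 (real_of_int (s - 1)) *\<^sub>R \<phi> 1 (\<Delta> (fst u) (s - 1))) t
        - (\<mu> * \<rho> 3 (real_of_int t)) *\<^sub>R \<phi> 3 (fst u t)
        + gradient (\<lambda>x. W t x (snd u t)) (fst u t) = 0 \<and>
      \<mu> *\<^sub>R \<Delta> (\<lambda>s. \<rho> 2 (real_of_int (s - 1)) *\<^sub>R \<phi> 2 (\<Delta> (snd u) (s - 1))) t
        - (\<mu> * \<rho> 4 (real_of_int t)) *\<^sub>R \<phi> 4 (snd u t)
        + gradient (\<lambda>x. W t (fst u t) x) (snd u t) = 0)"

end

theory Submission
  imports Defs
begin

text \<open>
On \<open>{\<Phi> = r}\<close> the functional \<open>\<mu>I + \<Psi> + \<lambda>\<Phi>\<close> exceeds its value at some point of \<open>{\<Phi> < r}\<close> (because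
\<open>\<mu> > \<mu>\<^sup>*\<close>) and at some point of \<open>{\<Phi> > r}\<close> (because \<open>\<lambda> < \<beta>\<close>), so it has a local minimum on either side and a
mountain pass point above the barrier. By (A5) it grows at least linearly, uniformly in \<open>\<lambda> \<in> [a,b]\<close>, so
everything happens in a fixed compact set \<open>{N \<le> R}\<close>, on which \<open>\<nu>\<Sum>H\<close> is a small perturbation. Critical
points are the periodic solutions, by summation by parts.

The minimax runs over connected sets containing both minima instead of paths. They can be deformed by a
single explicit gradient step of uniform length, so no flow is needed, and the minima stay in place
because the step fixes critical points.
\<close>

subsection \<open>A mountain pass principle for gradient steps\<close>

text \<open>On compact \<open>C\<close> the minimum of \<open>h u 0\<close> exceeds \<open>e\<close>
  by a fixed gap, and uniform continuity on \<open>C\<close> times \<open>{0..1}\<close> keeps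
  \<open>h u s\<close> within that gap for small \<open>s\<close>. This makes step lengths
  independent of the starting point.\<close>

lemma compact_tube:
  fixes h :: "'a::metric_space \<Rightarrow> real \<Rightarrow> real"
  assumes C: "compact C" and cont: "continuous_on (C \<times> {0..1}) (\<lambda>(u, s). h u s)"
    and pos: "\<And>u. u \<in> C \<Longrightarrow> e < h u 0"
  shows "\<exists>s0>0. \<forall>u\<in>C. \<forall>s\<in>{0..s0}. e < h u s"
proof (cases "C = {}")
  case True
  then show ?thesis by (auto intro!: exI[of _ 1])
next
  case False
  have "continuous_on C (\<lambda>u. case (u, 0) of (u, s) \<Rightarrow> h u s)"
    by (rule continuous_on_compose2[OF cont]) (auto intro!: continuous_intros)
  then obtain v where v: "v \<in> C" "\<And>u. u \<in> C \<Longrightarrow> h v 0 \<le> h u 0"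
    using continuous_attains_inf[OF C False] by fastforce
  have "uniformly_continuous_on (C \<times> {0..1}) (\<lambda>(u, s). h u s)"
    by (intro compact_uniformly_continuous cont compact_Times C) auto
  then obtain d where d: "d > 0" "\<And>x y. x \<in> C \<times> {0..1} \<Longrightarrow> y \<in> C \<times> {0..1} \<Longrightarrow> dist y x < d \<Longrightarrow>
      dist (case_prod h y) (case_prod h x) < h v 0 - e"
    unfolding uniformly_continuous_on_def using pos[OF v(1)] by (metis diff_gt_0_iff_gt)
  have "e < h u s" if "u \<in> C" "s \<in> {0..min 1 (d / 2)}" for u s
  proof -
    have "dist (case_prod h (u, s)) (case_prod h (u, 0)) < h v 0 - e"
      using that d(1) by (intro d(2)) (auto simp: dist_Pair_Pair dist_real_def)
    then show ?thesis using v(2)[OF that(1)] by (auto simp: dist_real_def)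
  qed
  then show ?thesis using d(1) by (intro exI[of _ "min 1 (d / 2)"]) auto
qed

text \<open>\<open>P u s\<close> is the gradient step of length \<open>s\<close> from \<open>u\<close>; \<open>D u 0 = 0\<close> encodes that \<open>u\<close> is critical.\<close>

locale descent_system =
  fixes X :: "'a::metric_space set" and f :: "'a \<Rightarrow> real" and P :: "'a \<Rightarrow> real \<Rightarrow> 'a"
    and D :: "'a \<Rightarrow> real \<Rightarrow> real"
  assumes cont_f: "continuous_on X f"
    and cont_P: "continuous_on (X \<times> UNIV) (\<lambda>(u, s). P u s)"
    and cont_D: "continuous_on (X \<times> UNIV) (\<lambda>(u, s). D u s)"
    and P_in: "u \<in> X \<Longrightarrow> P u s \<in> X"
    and P_0: "u \<in> X \<Longrightarrow> P u 0 = u"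
    and deriv: "u \<in> X \<Longrightarrow> ((\<lambda>s. f (P u s)) has_real_derivative - D u s) (at s)"
    and D_nonneg: "u \<in> X \<Longrightarrow> 0 \<le> D u 0"
    and P_fixed: "u \<in> X \<Longrightarrow> D u 0 = 0 \<Longrightarrow> P u s = u"
begin

lemma cont_comp_P:
  assumes "continuous_on X h"
  shows "continuous_on (X \<times> UNIV) (\<lambda>(u, s). h (P u s))"
  using continuous_on_compose2[OF assms cont_P] P_in by (force simp: case_prod_unfold)

lemma cont_D0: "continuous_on X (\<lambda>u. D u 0)"
proof -
  have "continuous_on X (\<lambda>u. case (u, 0) of (u, s) \<Rightarrow> D u s)"
    by (rule continuous_on_compose2[OF cont_D]) (auto intro!: continuous_intros)
  then show ?thesis by simp
qed

text \<open>If the slope were positive, a short gradient step would lower \<open>f\<close> while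
  preserving both strict inequalities. Later one constraint is the ball and the other the side of
  the barrier.\<close>

lemma min_critical:
  fixes h k :: "'a \<Rightarrow> real"
  assumes u: "u \<in> X" and h: "continuous_on X h" "h u < 0" and k: "continuous_on X k" "k u < 0"
    and min: "\<And>v. v \<in> X \<Longrightarrow> h v < 0 \<Longrightarrow> k v < 0 \<Longrightarrow> f u \<le> f v"
  shows "D u 0 = 0"
proof (rule ccontr)
  assume "D u 0 \<noteq> 0"
  then have "- D u 0 < 0" using D_nonneg[OF u] by simp
  from DERIV_neg_dec_right[OF deriv[OF u] this] obtain d where
    d: "d > 0" "\<And>s. 0 < s \<Longrightarrow> s < d \<Longrightarrow> f (P u s) < f u" using P_0[OF u] by auto
  have stay: "\<exists>s0>0. \<forall>s\<in>{0..s0}. g (P u s) < 0" if g: "continuous_on X g" "g u < 0" for g :: "'a \<Rightarrow> real"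
  proof -
    have "continuous_on X (\<lambda>v. - g v)" by (intro continuous_intros g)
    then have "continuous_on ({u} \<times> {0..1}) (\<lambda>(v, s). - g (P v s))"
      by (rule continuous_on_subset[OF cont_comp_P]) (use u in auto)
    from compact_tube[OF _ this, of 0] show ?thesis using g P_0[OF u] by simp
  qed
  obtain s0 s1 where "s0 > 0" "\<forall>s\<in>{0..s0}. h (P u s) < 0" "s1 > 0" "\<forall>s\<in>{0..s1}. k (P u s) < 0"
    using stay[OF h] stay[OF k] by blast
  then have "f u \<le> f (P u (min (d / 2) (min s0 s1)))"
    using u d(1) by (intro min P_in) auto
  moreover have "f (P u (min (d / 2) (min s0 s1))) < f u"
    using d(1) \<open>s0 > 0\<close> \<open>s1 > 0\<close> by (intro d(2)) auto
  ultimately show False by simp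
qed

text \<open>The level \<open>c\<close> is the infimum of the heights at which \<open>p\<close> and
  \<open>q\<close> can be joined inside the ball. The set \<open>S0\<close> forces
  \<open>c < M\<close>, so low enough points stay off the sphere \<open>N u = R\<close>. Without a
  critical point at level \<open>c\<close>, one gradient step pushes a nearly optimal connected set
  strictly below \<open>c\<close>.\<close>

lemma mountain_pass:
  fixes N :: "'a \<Rightarrow> real"
  assumes N: "continuous_on X N" and K: "compact {u \<in> X. N u \<le> R}"
    and bdry: "\<And>u. u \<in> X \<Longrightarrow> N u = R \<Longrightarrow> M < f u"
    and p: "p \<in> X" "D p 0 = 0" and q: "q \<in> X" "D q 0 = 0"
    and S0: "connected S0" "S0 \<subseteq> {u \<in> X. N u \<le> R}" "p \<in> S0" "q \<in> S0" "\<And>u. u \<in> S0 \<Longrightarrow> f u \<le> z0" "z0 < M"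
    and barrier: "\<And>S. connected S \<Longrightarrow> S \<subseteq> {u \<in> X. N u \<le> R} \<Longrightarrow> p \<in> S \<Longrightarrow> q \<in> S \<Longrightarrow> \<exists>u\<in>S. b \<le> f u"
  shows "\<exists>u\<in>X. N u < R \<and> D u 0 = 0 \<and> b \<le> f u"
proof (rule ccontr)
  define K where "K = {u \<in> X. N u \<le> R}"
  have KX: "K \<subseteq> X" and cK: "compact K" and clX: "S \<subseteq> K \<Longrightarrow> S \<subseteq> X" for S
    using K by (auto simp: K_def)
  have coK: "compact {u \<in> K. h u \<le> e}" if "continuous_on X h" for h :: "'a \<Rightarrow> real" and e
  proof -
    have "closed (K \<inter> h -` {..e})"
      by (rule continuous_closed_preimage[OF continuous_on_subset[OF that KX] compact_imp_closed[OF cK] closed_atMost])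
    from compact_Int_closed[OF cK this] have "compact (K \<inter> h -` {..e})" by simp
    moreover have "{u \<in> K. h u \<le> e} = K \<inter> h -` {..e}" by auto
    ultimately show ?thesis by simp
  qed
  \<comment> \<open>\<open>Z\<close> collects all upper bounds of \<open>f\<close> on admissible
    sets, so no supremum over a set has to be attained or even formed.\<close>
  define Z where "Z = {z. \<exists>S. connected S \<and> S \<subseteq> K \<and> p \<in> S \<and> q \<in> S \<and> (\<forall>u\<in>S. f u \<le> z)}"
  define c where "c = Inf Z"
  assume no: "\<not> ?thesis"
  have Zb: "b \<le> z" if "z \<in> Z" for z
    using that barrier unfolding Z_def K_def by (smt (verit) mem_Collect_eq)
  have z0: "z0 \<in> Z" unfolding Z_def K_def using S0 by blast
  have bdd: "bdd_below Z" using Zb by (rule bdd_belowI)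
  have bc: "b \<le> c" unfolding c_def using Zb z0 by (intro cInf_greatest) auto
  have cM: "c < M" unfolding c_def using cInf_lower[OF z0 bdd] S0(6) by simp
  \<comment> \<open>A zero of this sum would be critical at level \<open>c\<close>. Then
    \<open>b \<le> c\<close>, and \<open>c < M\<close> excludes the sphere, so it would be the point
    assumed not to exist.\<close>
  have pos: "0 < \<bar>f u - c\<bar> + D u 0" if "u \<in> K" for u
  proof (rule ccontr)
    assume "\<not> ?thesis"
    then have "f u = c" "D u 0 = 0" "u \<in> X" using D_nonneg[of u] that KX by auto
    then show False using no bc cM bdry[of u] that unfolding K_def by force
  qed
  have "K \<noteq> {}" using S0 by (auto simp: K_def)
  moreover have "continuous_on K (\<lambda>u. \<bar>f u - c\<bar> + D u 0)"
    by (intro continuous_intros continuous_on_subset[OF _ KX] cont_f cont_D0)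
  ultimately obtain v where v: "v \<in> K" "\<And>u. u \<in> K \<Longrightarrow> \<bar>f v - c\<bar> + D v 0 \<le> \<bar>f u - c\<bar> + D u 0"
    using continuous_attains_inf[OF cK] by blast
  \<comment> \<open>Half the minimum of \<open>\<bar>f u - c\<bar> + D u 0\<close>: a point within
    \<open>k\<close> of level \<open>c\<close> then has slope at least \<open>k\<close>. The second
    bound keeps \<open>c + k\<close> below the boundary values.\<close>
  define k where "k = min ((\<bar>f v - c\<bar> + D v 0) / 2) ((M - c) / 2)"
  have k: "0 < k" "c + k < M" using pos[OF v(1)] cM by (auto simp: k_def min_def field_simps)
  have kD: "k \<le> D u 0" if "u \<in> K" "\<bar>f u - c\<bar> \<le> k" for u
    using v(2)[OF that(1)] that(2) by (auto simp: k_def min_def split: if_splits)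
  have cs: "continuous_on (S \<times> {0..1}) (\<lambda>(u, s). h u s)"
    if "continuous_on (X \<times> UNIV) (\<lambda>(u, s). h u s)" "S \<subseteq> K" for h :: "'a \<Rightarrow> real \<Rightarrow> real" and S
    using that KX by (auto elim!: continuous_on_subset)
  \<comment> \<open>Three uniform step lengths follow: \<open>s1\<close> keeps the slope above
    \<open>k / 2\<close> near level \<open>c\<close>, \<open>s2\<close> keeps the step inside the
    ball, and \<open>s3\<close> keeps points that are already low below
    \<open>c - k / 2\<close>.\<close>
  have "\<exists>s0>0. \<forall>u\<in>{u \<in> K. \<bar>f u - c\<bar> \<le> k}. \<forall>s\<in>{0..s0}. k / 2 < D u s"
    using kD k(1) by (intro compact_tube cs cont_D coK continuous_intros cont_f) force+
  then obtain s1 where s1: "s1 > 0" "\<And>u s. u \<in> K \<Longrightarrow> \<bar>f u - c\<bar> \<le> k \<Longrightarrow> 0 \<le> s \<Longrightarrow> s \<le> s1 \<Longrightarrow> k / 2 < D u s"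
    by force
  have "\<exists>s0>0. \<forall>u\<in>{u \<in> K. f u \<le> c + k}. \<forall>s\<in>{0..s0}. 0 < R - N (P u s)"
  proof (intro compact_tube cs cont_comp_P[of "\<lambda>u. R - N u"] coK continuous_intros cont_f N)
    fix u assume u: "u \<in> {u \<in> K. f u \<le> c + k}"
    then show "0 < R - N (P u 0)" using k bdry[of u] P_0[of u] by (force simp: K_def)
  qed auto
  then obtain s2 where s2: "s2 > 0" "\<And>u s. u \<in> K \<Longrightarrow> f u \<le> c + k \<Longrightarrow> 0 \<le> s \<Longrightarrow> s \<le> s2 \<Longrightarrow> N (P u s) < R"
    by force
  have "\<exists>s0>0. \<forall>u\<in>{u \<in> K. f u \<le> c - k}. \<forall>s\<in>{0..s0}. k / 2 - c < - f (P u s)"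
  proof (intro compact_tube cs cont_comp_P[of "\<lambda>u. - f u"] coK continuous_intros cont_f)
    fix u assume u: "u \<in> {u \<in> K. f u \<le> c - k}"
    then show "k / 2 - c < - f (P u 0)" using k P_0[of u] by (auto simp: K_def)
  qed auto
  then obtain s3 where s3: "s3 > 0" "\<And>u s. u \<in> K \<Longrightarrow> f u \<le> c - k \<Longrightarrow> 0 \<le> s \<Longrightarrow> s \<le> s3 \<Longrightarrow> f (P u s) < c - k / 2"
    by force
  define s where "s = min s1 (min s2 s3)"
  have s: "0 < s" "s \<le> s1" "s \<le> s2" "s \<le> s3" using s1 s2 s3 by (auto simp: s_def)
  \<comment> \<open>Tolerance for a nearly optimal set: a step from near level \<open>c\<close>
    gains at least \<open>s * k / 2\<close>, so an excess of at most \<open>s * k / 4\<close> still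
    ends below \<open>c - s * k / 4\<close>. The bound \<open>k\<close> keeps the set where
    \<open>s2\<close> applies.\<close>
  define e where "e = min k (s * k / 4)"
  have e: "0 < e" "e \<le> k" "e \<le> s * k / 4" using s k by (auto simp: e_def)
  have "Inf Z < c + e" using e(1) by (simp add: c_def)
  then obtain z where z: "z \<in> Z" "z < c + e" using z0 cInf_lessD by blast
  then obtain S where S: "connected S" "S \<subseteq> K" "p \<in> S" "q \<in> S" "\<forall>u\<in>S. f u \<le> z"
    unfolding Z_def by auto
  define S' where "S' = (\<lambda>u. P u s) ` S"
  have "continuous_on S (\<lambda>u. case (u, s) of (u, s) \<Rightarrow> P u s)"
    using S KX by (intro continuous_on_compose2[OF cont_P]) (auto intro!: continuous_intros)
  then have "connected S'" unfolding S'_def by (intro connected_continuous_image S) simp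
  moreover have "S' \<subseteq> K"
    using S z e s s2(2)[of _ s] P_in clX[OF S(2)] unfolding S'_def K_def
    by (smt (verit, best) image_subset_iff mem_Collect_eq subset_iff)
  moreover have "p \<in> S'" "q \<in> S'" using S P_fixed p q unfolding S'_def by (metis image_eqI)+
  moreover have "f w \<le> max (c - k / 2) (c - s * k / 4)" if w: "w \<in> S'" for w
  proof -
    obtain u where u: "u \<in> S" "w = P u s" using w by (auto simp: S'_def)
    have uK: "u \<in> K" "u \<in> X" "f u < c + e" using u S KX z by auto
    show ?thesis
    proof (cases "f u \<le> c - k")
      case True
      then show ?thesis using s3(2)[of u s] uK s u by simp
    next
      case False
      \<comment> \<open>The mean value theorem expresses the loss of height as \<open>s\<close>
        times a slope at an intermediate point, which \<open>s1\<close> bounds below.\<close>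
      obtain x where x: "0 < x" "x < s" "f (P u s) - f (P u 0) = (s - 0) * (- D u x)"
        using MVT2[OF s(1), of "\<lambda>s. f (P u s)" "\<lambda>s. - D u s"] deriv[OF uK(2)] by blast
      have "k / 2 < D u x" using False uK e x s by (intro s1(2)) auto
      then have "s * (k / 2) < s * D u x" using s(1) by simp
      then show ?thesis using x(3) P_0[OF uK(2)] uK(3) e(3) u(2) by simp
    qed
  qed
  ultimately have "max (c - k / 2) (c - s * k / 4) \<in> Z" unfolding Z_def by blast
  from cInf_lower[OF this bdd] have "c \<le> max (c - k / 2) (c - s * k / 4)" by (simp add: c_def)
  moreover have "0 < s * k" using s k by simp
  ultimately show False using k(1) by (auto simp: max_def split: if_splits)
qed

text \<open>Every point below the barrier lies in the smaller ball of radius \<open>R'\<close>,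
  where \<open>f \<le> z < M\<close>. Hence both minima are interior, and they can be joined below
  the boundary values, as the mountain pass requires.\<close>

lemma three_critical_points:
  fixes N Q :: "'a \<Rightarrow> real"
  assumes N: "continuous_on X N" and K: "compact {u \<in> X. N u \<le> R}"
    and Q: "continuous_on X Q"
    and bdry: "\<And>u. u \<in> X \<Longrightarrow> N u = R \<Longrightarrow> M < f u"
    and low: "\<And>u. u \<in> X \<Longrightarrow> N u \<le> R \<Longrightarrow> f u < b \<Longrightarrow> N u \<le> R'"
    and R': "R' \<le> R" "\<And>u. u \<in> X \<Longrightarrow> N u \<le> R' \<Longrightarrow> f u \<le> z" "z < M"
    and conn: "\<And>p q. p \<in> X \<Longrightarrow> q \<in> X \<Longrightarrow> N p \<le> R' \<Longrightarrow> N q \<le> R' \<Longrightarrow>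
      \<exists>S. connected S \<and> S \<subseteq> {u \<in> X. N u \<le> R'} \<and> p \<in> S \<and> q \<in> S"
    and barrier: "\<And>u. u \<in> X \<Longrightarrow> N u \<le> R \<Longrightarrow> Q u = r \<Longrightarrow> b \<le> f u"
    and v: "v \<in> X" "N v \<le> R" "Q v < r" "f v < b"
    and w: "w \<in> X" "N w \<le> R" "r < Q w" "f w < b"
  shows "\<exists>S \<subseteq> {u \<in> X. N u < R \<and> D u 0 = 0}. card S = 3"
proof -
  \<comment> \<open>Taking \<open>h\<close> as \<open>Q u - r\<close> and as \<open>r - Q u\<close>
    treats both sides at once. The minimum is taken over the closed side \<open>h u \<le> 0\<close>;
    its value is below \<open>b\<close>, so the barrier excludes \<open>h p = 0\<close>.\<close>
  have min_in: "\<exists>p\<in>X. N p \<le> R' \<and> D p 0 = 0 \<and> f p < b \<and> h p < 0"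
    if h: "continuous_on X h" "\<And>u. u \<in> X \<Longrightarrow> N u \<le> R \<Longrightarrow> h u = 0 \<Longrightarrow> b \<le> f u"
      and x: "x \<in> X" "N x \<le> R" "h x < 0" "f x < b" for h :: "'a \<Rightarrow> real" and x
  proof -
    let ?A = "{u \<in> X. N u \<le> R} \<inter> h -` {..0}"
    have "closed ?A"
      by (rule continuous_closed_preimage[OF continuous_on_subset[OF h(1)] compact_imp_closed[OF K] closed_atMost]) auto
    then have "compact ({u \<in> X. N u \<le> R} \<inter> ?A)" by (intro compact_Int_closed K)
    moreover have "?A \<noteq> {}" using x by force
    moreover have "continuous_on ?A f" by (rule continuous_on_subset[OF cont_f]) auto
    ultimately obtain p where p: "p \<in> ?A" "\<forall>u\<in>?A. f p \<le> f u"
      using continuous_attains_inf[of ?A f] by auto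
    have "f p \<le> f x" using p(2) x by simp
    then have fp: "f p < b" using x(4) by simp
    then have "h p < 0" "N p \<le> R'" using p(1) h(2)[of p] low[of p] by force+
    moreover have "N p < R"
    proof (rule ccontr)
      assume "\<not> N p < R"
      then have "M < f p" using bdry[of p] p(1) by simp
      moreover have "f p \<le> z" using R' p(1) \<open>N p \<le> R'\<close> by simp
      ultimately show False using R'(3) by simp
    qed
    moreover have "D p 0 = 0"
      using p(2) p(1) \<open>N p < R\<close> \<open>h p < 0\<close>
      by (intro min_critical[of p "\<lambda>u. N u - R" h] continuous_intros N h(1)) auto
    ultimately show ?thesis using p(1) fp by blast
  qed
  from min_in[of "\<lambda>u. Q u - r" v] obtain p where
    p: "p \<in> X" "N p \<le> R'" "D p 0 = 0" "f p < b" "Q p < r"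
    using v barrier Q by (force intro!: continuous_intros)
  from min_in[of "\<lambda>u. r - Q u" w] obtain q where
    q: "q \<in> X" "N q \<le> R'" "D q 0 = 0" "f q < b" "r < Q q"
    using w barrier Q by (force intro!: continuous_intros)
  obtain S0 where S0: "connected S0" "S0 \<subseteq> {u \<in> X. N u \<le> R'}" "p \<in> S0" "q \<in> S0"
    using conn p q by blast
  have "\<exists>u\<in>X. N u < R \<and> D u 0 = 0 \<and> b \<le> f u"
  proof (rule mountain_pass[OF N K bdry p(1,3) q(1,3) S0(1) _ S0(3,4) _ R'(3)])
    show "S0 \<subseteq> {u \<in> X. N u \<le> R}" using S0 R'(1) by force
    show "f u \<le> z" if "u \<in> S0" for u using S0 R'(2) that by blast
    fix S assume S: "connected S" "S \<subseteq> {u \<in> X. N u \<le> R}" "p \<in> S" "q \<in> S"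
    have "continuous_on S Q" by (rule continuous_on_subset[OF Q]) (use S in auto)
    then have "connected (Q ` S)" using S by (intro connected_continuous_image)
    \<comment> \<open>The image of \<open>S\<close> under \<open>Q\<close> is an interval containing
      values on both sides of \<open>r\<close>, so every admissible set crosses the barrier.\<close>
    then have "r \<in> Q ` S"
      using connectedD_interval[of "Q ` S" "Q p" "Q q" r] S p q by force
    then show "\<exists>u\<in>S. b \<le> f u" using barrier S(2) by fastforce
  qed
  then obtain u where u: "u \<in> X" "N u < R" "D u 0 = 0" "b \<le> f u" by blast
  have lt: "N x < R" if "x \<in> X" "N x \<le> R'" for x
    using bdry[OF that(1)] R' that by (metis linorder_not_less nless_le order_trans)
  \<comment> \<open>\<open>p\<close> and \<open>q\<close> are separated by the value of
    \<open>Q\<close>, and \<open>u\<close> from both by its height.\<close>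
  have "p \<noteq> q" "p \<noteq> u" "q \<noteq> u" using p(4,5) q(4,5) u(4) by auto
  then have "card {p, q, u} = 3" by simp
  then show ?thesis
    using p q u lt by (intro exI[of _ "{p, q, u}"]) auto
qed

end

subsection \<open>The variational structure of the periodic system\<close>

type_synonym 'n seq_pair = "(int \<Rightarrow> real ^ 'n) \<times> (int \<Rightarrow> real ^ 'n)"

lemma gradient_eqI: "GDERIV f x :> D \<Longrightarrow> gradient f x = D"
  unfolding gradient_def
proof (rule the_equality)
  fix D' assume "GDERIV f x :> D" "GDERIV f x :> D'"
  then have "(\<lambda>h. h \<bullet> D) = (\<lambda>h. h \<bullet> D')"
    unfolding gderiv_def by (rule has_derivative_unique)
  then show "D' = D" by (metis vector_eq_ldot)
qed

lemma C1_gderiv: "C1 f \<Longrightarrow> GDERIV f x :> gradient f x"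
  unfolding C1_def by (metis gradient_eqI)

lemma C1_continuous_gradient: "C1 f \<Longrightarrow> continuous_on UNIV (gradient f)"
  unfolding C1_def by (metis ext gradient_eqI)

lemma C1_continuous: "C1 f \<Longrightarrow> continuous_on UNIV f"
  using C1_gderiv[of f] unfolding gderiv_def
  by (auto intro!: continuous_at_imp_continuous_on dest: has_derivative_continuous)

lemma GDERIV_comp_line:
  assumes "GDERIV f (a + s *\<^sub>R b) :> D"
  shows "((\<lambda>s. f (a + s *\<^sub>R b)) has_real_derivative D \<bullet> b) (at s)"
proof -
  have "((\<lambda>s. a + s *\<^sub>R b) has_derivative (\<lambda>h. h *\<^sub>R b)) (at s)"
    by (auto intro!: derivative_eq_intros)
  from has_derivative_compose[OF this assms[unfolded gderiv_def]]
  show ?thesis unfolding has_field_derivative_def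
    by (rule has_derivative_eq_rhs) (simp add: inner_commute fun_eq_iff mult.commute)
qed

text \<open>Restricting the joint derivative to increments \<open>(h, 0)\<close> gives the partial
  gradient. Continuity of the partial gradient in both variables thus comes from
  \<open>C1\<close>.\<close>

lemma gradient_fst:
  assumes "C1 (\<lambda>x. w (fst x) (snd x))"
  shows "gradient (\<lambda>x. w x y) x = fst (gradient (\<lambda>x. w (fst x) (snd x)) (x, y))"
proof (rule gradient_eqI)
  have "((\<lambda>x. (x, y)) has_derivative (\<lambda>h. (h, 0))) (at x)"
    by (auto intro!: derivative_eq_intros)
  from has_derivative_compose[OF this C1_gderiv[OF assms, unfolded gderiv_def]]
  show "GDERIV (\<lambda>x. w x y) x :> fst (gradient (\<lambda>x. w (fst x) (snd x)) (x, y))"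
    unfolding gderiv_def by (simp add: inner_prod_def)
qed

lemma gradient_snd:
  assumes "C1 (\<lambda>x. w (fst x) (snd x))"
  shows "gradient (\<lambda>y. w x y) y = snd (gradient (\<lambda>x. w (fst x) (snd x)) (x, y))"
proof (rule gradient_eqI)
  have "((\<lambda>y. (x, y)) has_derivative (\<lambda>h. (0, h))) (at y)"
    by (auto intro!: derivative_eq_intros)
  from has_derivative_compose[OF this C1_gderiv[OF assms, unfolded gderiv_def]]
  show "GDERIV (\<lambda>y. w x y) y :> snd (gradient (\<lambda>x. w (fst x) (snd x)) (x, y))"
    unfolding gderiv_def by (simp add: inner_prod_def)
qed

lemma C1_linear_combination:
  assumes "C1 f" "C1 g" "C1 h"
  shows "C1 (\<lambda>x. f x - a * g x + b * h x)"
proof -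
  obtain f' g' h' where D: "\<And>x. GDERIV f x :> f' x" "\<And>x. GDERIV g x :> g' x" "\<And>x. GDERIV h x :> h' x"
    and C: "continuous_on UNIV f'" "continuous_on UNIV g'" "continuous_on UNIV h'"
    using assms unfolding C1_def by metis
  have "GDERIV (\<lambda>x. f x - a * g x + b * h x) x :> f' x - a *\<^sub>R g' x + b *\<^sub>R h' x" for x
    using D[of x] unfolding gderiv_def
    by (auto intro!: derivative_eq_intros simp: inner_diff_right inner_add_right)
  then show ?thesis unfolding C1_def
    by (intro exI[of _ "\<lambda>x. f' x - a *\<^sub>R g' x + b *\<^sub>R h' x"]) (auto intro!: continuous_intros C)
qed

section \<open>Periodic sequences and summation by parts\<close>

lemma periodic_mod:
  fixes h :: "int \<Rightarrow> 'b"
  assumes "\<And>t. h (t + T) = h t"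
  shows "h t = h (1 + (t - 1) mod T)"
proof -
  have n: "h (t + int n * T) = h t" for t n
  proof (induction n)
    case (Suc n)
    have "t + int (Suc n) * T = (t + int n * T) + T" by (simp add: algebra_simps)
    then show ?case using Suc assms[of "t + int n * T"] by presburger
  qed simp
  have "h (t + k * T) = h t" for t k
  proof (cases "k \<ge> 0")
    case True
    then show ?thesis using n[of t "nat k"] by simp
  next
    case False
    then show ?thesis using n[of "t + k * T" "nat (- k)"] by simp
  qed
  from this[of "1 + (t - 1) mod T" "(t - 1) div T"]
  have "h (1 + (t - 1) mod T + (t - 1) div T * T) = h (1 + (t - 1) mod T)" .
  moreover have "1 + (t - 1) mod T + (t - 1) div T * T = t"
    using div_mult_mod_eq[of "t - 1" T] by linarith
  ultimately show ?thesis by simp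
qed

lemma mod_in_period:
  fixes T t :: int
  assumes "0 < T"
  shows "1 + (t - 1) mod T \<in> {1..T}"
  using pos_mod_bound[OF assms, of "t - 1"] pos_mod_sign[OF assms, of "t - 1"]
  unfolding atLeastAtMost_iff by linarith

lemma sum_shift_periodic:
  fixes h :: "int \<Rightarrow> 'b::ab_group_add"
  assumes per: "\<And>t. h (t + T) = h t" and T: "1 \<le> T"
  shows "(\<Sum>t\<in>{1..T}. h (t + 1)) = (\<Sum>t\<in>{1..T}. h t)"
proof -
  have "(\<Sum>t\<in>{1..T}. h (t + 1)) = (\<Sum>t\<in>{2..T + 1}. h t)"
    by (rule sum.reindex_bij_witness[of _ "\<lambda>t. t - 1" "\<lambda>t. t + 1"]) auto
  also have "{2..T + 1} = insert (T + 1) {2..T}" using T by auto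
  also have "(\<Sum>t\<in>insert (T + 1) {2..T}. h t) = h 1 + (\<Sum>t\<in>{2..T}. h t)"
    using per[of 1] by (simp add: add.commute)
  also have "\<dots> = (\<Sum>t\<in>insert 1 {2..T}. h t)" by simp
  also have "insert 1 {2..T} = {1..T}" using T by auto
  finally show ?thesis .
qed

text \<open>Shifting the index over a full period turns \<open>a t \<bullet> v (t + 1)\<close> into
  \<open>a (t - 1) \<bullet> v t\<close>; periodicity leaves no boundary terms.\<close>

lemma sum_by_parts_periodic:
  fixes a v :: "int \<Rightarrow> 'b::real_inner"
  assumes "\<And>t. a (t + T) = a t" "\<And>t. v (t + T) = v t" "1 \<le> T"
  shows "(\<Sum>t\<in>{1..T}. a t \<bullet> \<Delta> v t) = - (\<Sum>t\<in>{1..T}. \<Delta> (\<lambda>s. a (s - 1)) t \<bullet> v t)"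
proof -
  have "a (t + T - 1) \<bullet> v (t + T) = a (t - 1) \<bullet> v t" for t
    using assms(1)[of "t - 1"] assms(2)[of t] by (simp add: algebra_simps)
  from sum_shift_periodic[of "\<lambda>t. a (t - 1) \<bullet> v t", OF this assms(3)]
  have "(\<Sum>t\<in>{1..T}. a t \<bullet> v (t + 1)) = (\<Sum>t\<in>{1..T}. a (t - 1) \<bullet> v t)" by simp
  then show ?thesis
    by (simp add: fdiff_def inner_diff_left inner_diff_right sum_subtractf)
qed

text \<open>Sequences carry the product topology, so continuity of the functionals reduces to
  continuity in finitely many coordinates.\<close>

lemma continuous_seq_coordinates:
  "continuous_on S (\<lambda>u. fst u t)" "continuous_on S (\<lambda>u. snd u t)"
  for S :: "'n::finite seq_pair set"
  by (rule continuous_on_product_then_coordinatewise, intro continuous_on_fst continuous_on_snd continuous_on_id)+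

section \<open>The action functional and its gradient step\<close>

locale periodic_system =
  fixes T :: int and \<rho> :: "nat \<Rightarrow> real \<Rightarrow> real"
    and \<phi> :: "nat \<Rightarrow> real ^ 'n \<Rightarrow> real ^ 'n" and \<Phi> :: "nat \<Rightarrow> real ^ 'n \<Rightarrow> real"
    and W :: "int \<Rightarrow> real ^ 'n \<Rightarrow> real ^ 'n \<Rightarrow> real" and \<mu> :: real
  assumes T: "1 \<le> T"
    and rho_periodic: "i \<in> {1..4} \<Longrightarrow> \<rho> i (s + real_of_int T) = \<rho> i s"
    and potential: "i \<in> {1..4} \<Longrightarrow> C1 (\<Phi> i)" "i \<in> {1..4} \<Longrightarrow> \<phi> i = gradient (\<Phi> i)"
    and W_periodic: "W (t + T) = W t"
    and W_C1: "C1 (\<lambda>x. W t (fst x) (snd x))"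
begin

definition action :: "'n seq_pair \<Rightarrow> real" where
  "action u = \<mu> * I_fun T \<rho> \<Phi> u - (\<Sum>t\<in>{1..T}. W t (fst u t) (snd u t))"

text \<open>Left-hand side of the first equation. On periodic pairs it is minus the gradient of
  \<open>action\<close> with respect to \<open>fst u t\<close>, so the residuals form the steepest
  descent direction.\<close>

definition residual1 :: "'n seq_pair \<Rightarrow> int \<Rightarrow> real ^ 'n" where
  "residual1 u t =
      \<mu> *\<^sub>R \<Delta> (\<lambda>s. \<rho> 1 (real_of_int (s - 1)) *\<^sub>R \<phi> 1 (\<Delta> (fst u) (s - 1))) t
        - (\<mu> * \<rho> 3 (real_of_int t)) *\<^sub>R \<phi> 3 (fst u t)
        + gradient (\<lambda>x. W t x (snd u t)) (fst u t)"

definition residual2 :: "'n seq_pair \<Rightarrow> int \<Rightarrow> real ^ 'n" where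
  "residual2 u t =
      \<mu> *\<^sub>R \<Delta> (\<lambda>s. \<rho> 2 (real_of_int (s - 1)) *\<^sub>R \<phi> 2 (\<Delta> (snd u) (s - 1))) t
        - (\<mu> * \<rho> 4 (real_of_int t)) *\<^sub>R \<phi> 4 (snd u t)
        + gradient (\<lambda>x. W t (fst u t) x) (snd u t)"

definition gradient_step ::
    "'n seq_pair \<Rightarrow> real \<Rightarrow> 'n seq_pair" where
  "gradient_step u s =
    (\<lambda>t. fst u t + s *\<^sub>R residual1 u t, \<lambda>t. snd u t + s *\<^sub>R residual2 u t)"

text \<open>Minus the derivative of \<open>action\<close> along the step: the direction stays frozen
  at \<open>u\<close> while the gradient is taken at the moved point. At \<open>s = 0\<close> it is
  the squared length of the residual over one period.\<close>

definition slope :: "'n seq_pair \<Rightarrow> real \<Rightarrow> real" where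
  "slope u s = (\<Sum>t\<in>{1..T}. residual1 (gradient_step u s) t \<bullet> residual1 u t
      + residual2 (gradient_step u s) t \<bullet> residual2 u t)"

lemma solves_system_iff:
  "solves_system \<rho> \<phi> W \<mu> u \<longleftrightarrow> (\<forall>t. residual1 u t = 0 \<and> residual2 u t = 0)"
  unfolding solves_system_def residual1_def residual2_def ..

lemma rho_periodic_int: "i \<in> {1..4} \<Longrightarrow> \<rho> i (real_of_int (t + T)) = \<rho> i (real_of_int t)"
  using rho_periodic[of i "real_of_int t"] by simp

lemma flux_periodic:
  assumes "i \<in> {1..4}" "h \<in> E_per T"
  shows "\<rho> i (real_of_int (t + T)) *\<^sub>R \<phi> i (\<Delta> h (t + T)) = \<rho> i (real_of_int t) *\<^sub>R \<phi> i (\<Delta> h t)"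
proof -
  have h: "h (t + T) = h t" for t using assms(2) by (simp add: E_per_def)
  have "h (t + T + 1) = h (t + 1)" using h[of "t + 1"] by (simp add: ac_simps)
  then show ?thesis using rho_periodic_int[OF assms(1), of t] h by (simp add: fdiff_def)
qed

lemma residual_periodic:
  assumes "u \<in> E_pair T"
  shows "residual1 u (t + T) = residual1 u t" "residual2 u (t + T) = residual2 u t"
proof -
  have h: "fst u \<in> E_per T" "snd u \<in> E_per T" using assms by (auto simp: E_pair_def)
  then have u: "fst u (t + T) = fst u t" "snd u (t + T) = snd u t" for t by (auto simp: E_per_def)
  have flux: "\<Delta> (\<lambda>s. \<rho> i (real_of_int (s - 1)) *\<^sub>R \<phi> i (\<Delta> h (s - 1))) (t + T) =
      \<Delta> (\<lambda>s. \<rho> i (real_of_int (s - 1)) *\<^sub>R \<phi> i (\<Delta> h (s - 1))) t"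
    if "i \<in> {1..4}" "h \<in> E_per T" for i h
  proof -
    have "t + T - 1 = t - 1 + T" by simp
    then show ?thesis using flux_periodic[OF that, of t] flux_periodic[OF that, of "t - 1"]
      by (simp only: fdiff_def[of "\<lambda>s. \<rho> i (real_of_int (s - 1)) *\<^sub>R \<phi> i (\<Delta> h (s - 1))"] add_diff_cancel_right')
  qed
  have rho: "\<rho> i (real_of_int (t + T)) = \<rho> i (real_of_int t)" if "i \<in> {1..4}" for i
    using that by (rule rho_periodic_int)
  show "residual1 u (t + T) = residual1 u t"
    unfolding residual1_def u W_periodic using flux[OF _ h(1), of 1] rho[of 3] by simp
  show "residual2 u (t + T) = residual2 u t"
    unfolding residual2_def u W_periodic using flux[OF _ h(2), of 2] rho[of 4] by simp
qed

lemma gradient_step_in: "u \<in> E_pair T \<Longrightarrow> gradient_step u s \<in> E_pair T"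
  using residual_periodic[of u] by (auto simp: gradient_step_def E_pair_def E_per_def)

lemma phi_continuous: "i \<in> {1..4} \<Longrightarrow> continuous_on UNIV (\<phi> i)"
  using potential C1_continuous_gradient by metis

lemma continuous_residual:
  "continuous_on UNIV (\<lambda>u. residual1 u t)" "continuous_on UNIV (\<lambda>u. residual2 u t)"
proof -
  have phi: "continuous_on UNIV (\<lambda>u. \<phi> i (h u))" if "i \<in> {1..4}" "continuous_on UNIV h"
    for i and h :: "'n seq_pair \<Rightarrow> real ^ 'n"
    by (rule continuous_on_compose2[OF phi_continuous[OF that(1)] that(2) subset_UNIV])
  note cc = continuous_seq_coordinates[of UNIV]
  have flux: "continuous_on UNIV (\<lambda>u :: 'n seq_pair. \<phi> 1 (fst u (t + 1) - fst u t))"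
    "continuous_on UNIV (\<lambda>u :: 'n seq_pair. \<phi> 2 (snd u (t + 1) - snd u t))" for t
    by (rule phi[OF _ continuous_on_diff[OF cc(1) cc(1)]] phi[OF _ continuous_on_diff[OF cc(2) cc(2)]], simp)+
  have pot: "continuous_on UNIV (\<lambda>u :: 'n seq_pair. \<phi> 3 (fst u t))" "continuous_on UNIV (\<lambda>u :: 'n seq_pair. \<phi> 4 (snd u t))"
    by (rule phi[OF _ cc(1)] phi[OF _ cc(2)], simp)+
  have W: "continuous_on UNIV (\<lambda>u. gradient (\<lambda>x. W t (fst x) (snd x)) (fst u t, snd u t))"
    by (rule continuous_on_compose2[OF C1_continuous_gradient[OF W_C1] continuous_on_Pair[OF cc] subset_UNIV])
  show "continuous_on UNIV (\<lambda>u. residual1 u t)"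
    unfolding residual1_def fdiff_def gradient_fst[OF W_C1]
    by (intro continuous_on_add continuous_on_diff continuous_on_scaleR continuous_on_const
        continuous_on_fst W pot flux)
  show "continuous_on UNIV (\<lambda>u. residual2 u t)"
    unfolding residual2_def fdiff_def gradient_snd[OF W_C1]
    by (intro continuous_on_add continuous_on_diff continuous_on_scaleR continuous_on_const
        continuous_on_snd W pot flux)
qed

lemma continuous_gradient_step: "continuous_on UNIV (\<lambda>(u, s). gradient_step u s)"
proof -
  have "continuous_on UNIV (\<lambda>p. h (fst p) t)"
    if "\<And>t. continuous_on UNIV (\<lambda>u. h u t)"
    for h :: "'n seq_pair \<Rightarrow> int \<Rightarrow> real ^ 'n" and t
    by (rule continuous_on_compose2[OF that continuous_on_fst[OF continuous_on_id] subset_UNIV])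
  note this[OF continuous_seq_coordinates(1)] this[OF continuous_seq_coordinates(2)]
    this[OF continuous_residual(1)] this[OF continuous_residual(2)]
  then show ?thesis unfolding gradient_step_def case_prod_unfold
    by (intro continuous_on_Pair continuous_on_coordinatewise_then_product continuous_on_add
        continuous_on_scaleR continuous_on_snd continuous_on_id)
qed

lemma continuous_slope: "continuous_on UNIV (\<lambda>(u, s). slope u s)"
proof -
  have "continuous_on UNIV (\<lambda>p. h (fst p))" "continuous_on UNIV (\<lambda>p. h (case_prod gradient_step p))"
    if "continuous_on UNIV h" for h :: "'n seq_pair \<Rightarrow> real ^ 'n"
    by (rule continuous_on_compose2[OF that continuous_on_fst[OF continuous_on_id] subset_UNIV]
        continuous_on_compose2[OF that continuous_gradient_step subset_UNIV])+
  note this[OF continuous_residual(1)] this[OF continuous_residual(2)]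
  then show ?thesis unfolding slope_def case_prod_unfold
    by (intro continuous_on_sum continuous_on_add continuous_on_inner)
qed

text \<open>The chain rule applies term by term, and summation by parts moves the difference from
  \<open>v\<close> onto the fluxes, which produces the second-order terms of the system. Periodicity
  of both \<open>u\<close> and \<open>v\<close> enters there.\<close>

lemma action_line_derivative:
  assumes u: "u \<in> E_pair T" and v: "v \<in> E_pair T"
  defines "y \<equiv> \<lambda>s. (\<lambda>t. fst u t + s *\<^sub>R fst v t, \<lambda>t. snd u t + s *\<^sub>R snd v t)"
  shows "((\<lambda>s. action (y s)) has_real_derivative
    - (\<Sum>t\<in>{1..T}. residual1 (y s) t \<bullet> fst v t + residual2 (y s) t \<bullet> snd v t)) (at s)"
proof -
  have ys: "y s \<in> E_pair T" using u v by (auto simp: y_def E_pair_def E_per_def)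
  then have yE: "fst (y s) \<in> E_per T" "snd (y s) \<in> E_per T" by (auto simp: E_pair_def)
  have vE: "fst v (t + T) = fst v t" "snd v (t + T) = snd v t" for t
    using v by (auto simp: E_pair_def E_per_def)
  have diff: "\<Delta> (fst (y s)) t = \<Delta> (fst u) t + s *\<^sub>R \<Delta> (fst v) t"
    "\<Delta> (snd (y s)) t = \<Delta> (snd u) t + s *\<^sub>R \<Delta> (snd v) t" for s t
    by (simp_all add: y_def fdiff_def algebra_simps)
  have phi: "((\<lambda>s. \<Phi> i (a + s *\<^sub>R b)) has_real_derivative \<phi> i (a + s *\<^sub>R b) \<bullet> b) (at s)"
    if "i \<in> {1..4}" for i a b
    by (rule GDERIV_comp_line) (metis C1_gderiv potential that)
  have parts: "(\<Sum>t\<in>{1..T}. (\<rho> i (real_of_int t) *\<^sub>R \<phi> i (\<Delta> h t)) \<bullet> \<Delta> v t) =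
      - (\<Sum>t\<in>{1..T}. \<Delta> (\<lambda>s. \<rho> i (real_of_int (s - 1)) *\<^sub>R \<phi> i (\<Delta> h (s - 1))) t \<bullet> v t)"
    if "i \<in> {1..4}" "h \<in> E_per T" "\<And>t. v (t + T) = v t" for i h v
    by (rule sum_by_parts_periodic[of "\<lambda>t. \<rho> i (real_of_int t) *\<^sub>R \<phi> i (\<Delta> h t)"])
      (use flux_periodic[OF that(1,2)] that(3) T in auto)
  have i: "(1 :: nat) \<in> {1..4}" "(2 :: nat) \<in> {1..4}" by simp_all
  define g where "g t = gradient (\<lambda>x. W t (fst x) (snd x)) (fst (y s) t, snd (y s) t)" for t
  have Wd: "((\<lambda>s. W t (fst (y s) t) (snd (y s) t)) has_real_derivative
      fst (g t) \<bullet> fst v t + snd (g t) \<bullet> snd v t) (at s)" for t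
    using GDERIV_comp_line[OF C1_gderiv[OF W_C1[of t]],
        where a = "(fst u t, snd u t)" and s = s and b = "(fst v t, snd v t)"]
    by (simp add: y_def g_def inner_prod_def)
  have "((\<lambda>s. action (y s)) has_real_derivative
    \<mu> * (\<Sum>t\<in>{1..T}. \<rho> 1 (real_of_int t) * (\<phi> 1 (\<Delta> (fst (y s)) t) \<bullet> \<Delta> (fst v) t)
      + \<rho> 2 (real_of_int t) * (\<phi> 2 (\<Delta> (snd (y s)) t) \<bullet> \<Delta> (snd v) t)
      + \<rho> 3 (real_of_int t) * (\<phi> 3 (fst (y s) t) \<bullet> fst v t)
      + \<rho> 4 (real_of_int t) * (\<phi> 4 (snd (y s) t) \<bullet> snd v t))
    - (\<Sum>t\<in>{1..T}. fst (g t) \<bullet> fst v t + snd (g t) \<bullet> snd v t)) (at s)"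
    unfolding action_def I_fun_def diff
    by (intro DERIV_diff DERIV_cmult DERIV_sum DERIV_add Wd phi)
      (auto simp: y_def intro!: phi DERIV_cmult)
  also have "\<mu> * (\<Sum>t\<in>{1..T}. \<rho> 1 (real_of_int t) * (\<phi> 1 (\<Delta> (fst (y s)) t) \<bullet> \<Delta> (fst v) t)
      + \<rho> 2 (real_of_int t) * (\<phi> 2 (\<Delta> (snd (y s)) t) \<bullet> \<Delta> (snd v) t)
      + \<rho> 3 (real_of_int t) * (\<phi> 3 (fst (y s) t) \<bullet> fst v t)
      + \<rho> 4 (real_of_int t) * (\<phi> 4 (snd (y s) t) \<bullet> snd v t))
    - (\<Sum>t\<in>{1..T}. fst (g t) \<bullet> fst v t + snd (g t) \<bullet> snd v t) =
    \<mu> * (\<Sum>t\<in>{1..T}. (\<rho> 1 (real_of_int t) *\<^sub>R \<phi> 1 (\<Delta> (fst (y s)) t)) \<bullet> \<Delta> (fst v) t)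
      + \<mu> * (\<Sum>t\<in>{1..T}. (\<rho> 2 (real_of_int t) *\<^sub>R \<phi> 2 (\<Delta> (snd (y s)) t)) \<bullet> \<Delta> (snd v) t)
      + (\<Sum>t\<in>{1..T}. \<mu> * \<rho> 3 (real_of_int t) * (\<phi> 3 (fst (y s) t) \<bullet> fst v t)
        + \<mu> * \<rho> 4 (real_of_int t) * (\<phi> 4 (snd (y s) t) \<bullet> snd v t)
        - (fst (g t) \<bullet> fst v t + snd (g t) \<bullet> snd v t))"
    by (simp add: sum.distrib sum_subtractf sum_distrib_left algebra_simps)
  also have "\<dots> = - (\<Sum>t\<in>{1..T}. residual1 (y s) t \<bullet> fst v t + residual2 (y s) t \<bullet> snd v t)"
    unfolding parts[of 1 _ "fst v", OF i(1) yE(1) vE(1)] parts[of 2 _ "snd v", OF i(2) yE(2) vE(2)]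
      residual1_def residual2_def gradient_fst[OF W_C1] gradient_snd[OF W_C1] g_def[symmetric]
    by (simp add: sum.distrib sum_subtractf sum_distrib_left sum_negf algebra_simps inner_diff_left inner_add_left)
  finally show ?thesis .
qed

lemma continuous_action: "continuous_on UNIV action"
proof -
  have Phi: "continuous_on UNIV (\<lambda>u. \<Phi> i (h u))"
    if "i \<in> {1..4}" "continuous_on UNIV h" for i and h :: "'n seq_pair \<Rightarrow> _"
    using continuous_on_compose2[OF C1_continuous[OF potential(1)[OF that(1)]] that(2)] by simp
  have "continuous_on UNIV (\<lambda>u. W t (fst u t) (snd u t))" for t
    using continuous_on_compose2[OF C1_continuous[OF W_C1[of t]], of UNIV "\<lambda>u. (fst u t, snd u t)"]
    by (simp add: continuous_on_Pair continuous_seq_coordinates)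
  then show ?thesis unfolding action_def I_fun_def fdiff_def
    by (intro continuous_intros Phi continuous_seq_coordinates) auto
qed

lemma slope_0: "slope u 0 = (\<Sum>t\<in>{1..T}. (norm (residual1 u t))\<^sup>2 + (norm (residual2 u t))\<^sup>2)"
  by (simp add: slope_def gradient_step_def power2_norm_eq_inner)

text \<open>A vanishing sum of squares kills the residuals on one period, and their periodicity
  carries this to all integers.\<close>

lemma slope_0_eq_0:
  assumes "u \<in> E_pair T" "slope u 0 = 0"
  shows "residual1 u t = 0" "residual2 u t = 0"
proof -
  have "\<forall>t\<in>{1..T}. residual1 u t = 0 \<and> residual2 u t = 0"
    using assms(2) by (simp add: slope_0 sum_nonneg_eq_0_iff add_nonneg_eq_0_iff)
  then show "residual1 u t = 0" "residual2 u t = 0"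
    using periodic_mod[of "residual1 u" T t] periodic_mod[of "residual2 u" T t]
      residual_periodic[OF assms(1)] mod_in_period[of T t] T by auto
qed

sublocale descent_system "E_pair T" action gradient_step slope
proof
  show "continuous_on (E_pair T) action" "continuous_on (E_pair T \<times> UNIV) (\<lambda>(u, s). gradient_step u s)"
    "continuous_on (E_pair T \<times> UNIV) (\<lambda>(u, s). slope u s)"
    using continuous_action continuous_gradient_step continuous_slope continuous_on_subset by blast+
  fix u :: "'n seq_pair" and s :: real
  assume u: "u \<in> E_pair T"
  show "gradient_step u s \<in> E_pair T" using u by (rule gradient_step_in)
  show "gradient_step u 0 = u" by (simp add: gradient_step_def)
  show "0 \<le> slope u 0" by (auto simp: slope_0 intro!: sum_nonneg)
  show "slope u 0 = 0 \<Longrightarrow> gradient_step u s = u"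
    using slope_0_eq_0[OF u] by (simp add: gradient_step_def)
  \<comment> \<open>The descent direction is itself periodic, so it is an admissible direction for
    the line derivative.\<close>
  have "(residual1 u, residual2 u) \<in> E_pair T"
    using residual_periodic[OF u] by (simp add: E_pair_def E_per_def)
  from action_line_derivative[OF u this, of s]
  show "((\<lambda>s. action (gradient_step u s)) has_real_derivative - slope u s) (at s)"
    by (simp add: gradient_step_def slope_def)
qed

end

subsection \<open>Compactness and coercivity\<close>

text \<open>A working norm matching the linear coercivity bounds and convex along segments.
  \<open>norm_pair\<close> is compared with it only at the end, by boundedness on compact
  balls.\<close>

definition sum_norm_pair :: "int \<Rightarrow> 'n::finite seq_pair \<Rightarrow> real" where
  "sum_norm_pair T u = (\<Sum>t\<in>{1..T}. norm (fst u t) + norm (snd u t))"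

lemma continuous_sum_norm_pair: "continuous_on S (sum_norm_pair T)"
  unfolding sum_norm_pair_def
  by (intro continuous_on_sum continuous_on_add continuous_on_norm continuous_seq_coordinates)

lemma closed_E_pair: "closed (E_pair T :: 'n::finite seq_pair set)"
proof -
  have "E_pair T = (\<Inter>t. {u :: 'n seq_pair. fst u (t + T) = fst u t} \<inter> {u. snd u (t + T) = snd u t})"
    by (auto simp: E_pair_def E_per_def)
  then show ?thesis
    by (simp only:) (intro closed_INT ballI closed_Int closed_Collect_eq continuous_seq_coordinates)
qed

text \<open>The norm controls the coordinates in one period, hence by periodicity all of them. The
  set is therefore closed in a product of balls, which is compact by Tychonoff.\<close>

lemma compact_sum_norm_pair_le:
  assumes T: "1 \<le> T"
  shows "compact {u :: 'n::finite seq_pair. u \<in> E_pair T \<and> sum_norm_pair T u \<le> R}"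
proof -
  define Q where "Q = PiE UNIV (\<lambda>t :: int. cball (0 :: real ^ 'n) R)"
  have "compactin (product_topology (\<lambda>t :: int. euclidean) UNIV) Q"
    unfolding Q_def by (simp add: compactin_PiE)
  then have "compact Q" by (simp add: euclidean_product_topology)
  have coord: "norm (fst u t) \<le> R" "norm (snd u t) \<le> R"
    if "u \<in> E_pair T" "sum_norm_pair T u \<le> R" for u :: "'n seq_pair" and t
  proof -
    define t' where "t' = 1 + (t - 1) mod T"
    have t': "t' \<in> {1..T}" unfolding t'_def using T by (intro mod_in_period) auto
    have "norm (fst u t') + norm (snd u t') \<le> sum_norm_pair T u"
      unfolding sum_norm_pair_def using t' by (intro member_le_sum) auto
    moreover have eq: "fst u t = fst u t'" "snd u t = snd u t'"
      unfolding t'_def using that(1) by (auto simp: E_pair_def E_per_def intro!: periodic_mod)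
    ultimately show "norm (fst u t) \<le> R" "norm (snd u t) \<le> R"
      unfolding eq using that(2) norm_ge_zero[of "fst u t'"] norm_ge_zero[of "snd u t'"] by linarith+
  qed
  have "compact (Q \<times> Q \<inter> (E_pair T \<inter> {u. sum_norm_pair T u \<le> R}))"
    by (intro compact_Int_closed compact_Times \<open>compact Q\<close> closed_Int closed_E_pair
        closed_Collect_le continuous_sum_norm_pair continuous_on_const)
  also have "Q \<times> Q \<inter> (E_pair T \<inter> {u. sum_norm_pair T u \<le> R}) = {u \<in> E_pair T. sum_norm_pair T u \<le> R}"
    using coord by (auto simp: Q_def)
  finally show ?thesis .
qed

text \<open>The straight segment from \<open>p\<close> to \<open>q\<close> serves as
  \<open>S\<close>, since the norm is convex.\<close>

lemma connected_sum_norm_pair_le: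
  fixes p q :: "'n::finite seq_pair"
  assumes "p \<in> E_pair T" "q \<in> E_pair T" "sum_norm_pair T p \<le> R" "sum_norm_pair T q \<le> R"
  shows "\<exists>S. connected S \<and> S \<subseteq> {u \<in> E_pair T. sum_norm_pair T u \<le> R} \<and> p \<in> S \<and> q \<in> S"
proof -
  define y where "y s = (\<lambda>t. (1 - s) *\<^sub>R fst p t + s *\<^sub>R fst q t, \<lambda>t. (1 - s) *\<^sub>R snd p t + s *\<^sub>R snd q t)"
    for s :: real
  have "continuous_on {0..1} y" unfolding y_def
    by (intro continuous_on_Pair continuous_on_coordinatewise_then_product continuous_intros)
  then have "connected (y ` {0..1})" by (intro connected_continuous_image) auto
  moreover have "y s \<in> E_pair T" for s
    using assms(1,2) by (auto simp: y_def E_pair_def E_per_def)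
  moreover have "sum_norm_pair T (y s) \<le> R" if "s \<in> {0..1}" for s
  proof -
    have "sum_norm_pair T (y s) \<le> (\<Sum>t\<in>{1..T}. (1 - s) * (norm (fst p t) + norm (snd p t))
        + s * (norm (fst q t) + norm (snd q t)))"
      unfolding sum_norm_pair_def
    proof (rule sum_mono)
      fix t
      show "norm (fst (y s) t) + norm (snd (y s) t) \<le> (1 - s) * (norm (fst p t) + norm (snd p t))
        + s * (norm (fst q t) + norm (snd q t))"
        using that norm_triangle_ineq[of "(1 - s) *\<^sub>R fst p t" "s *\<^sub>R fst q t"]
          norm_triangle_ineq[of "(1 - s) *\<^sub>R snd p t" "s *\<^sub>R snd q t"]
        by (simp add: y_def distrib_left)
    qed
    also have "\<dots> = (1 - s) * sum_norm_pair T p + s * sum_norm_pair T q"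
      by (simp add: sum_norm_pair_def sum.distrib flip: sum_distrib_left)
    also have "\<dots> \<le> R" using that assms(3,4) by (intro convex_bound_le) auto
    finally show ?thesis .
  qed
  moreover have "y 0 = p" "y 1 = q" by (simp_all add: y_def)
  ultimately show ?thesis by (intro exI[of _ "y ` {0..1}"]) (auto intro: rev_image_eqI)
qed

lemma continuous_norm_pair:
  assumes "\<theta> > 1"
  shows "continuous_on S (norm_pair T \<theta> :: 'n::finite seq_pair \<Rightarrow> real)"
  unfolding norm_pair_def norm_per_def fdiff_def
  by (intro continuous_on_add continuous_on_powr' continuous_on_sum continuous_on_norm continuous_on_diff
      continuous_seq_coordinates continuous_on_const)
    (use assms in \<open>auto intro!: add_nonneg_nonneg sum_nonneg\<close>)

lemma continuous_Phi_fun: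
  assumes "\<And>t. t \<in> {1..T} \<Longrightarrow> C1 (\<lambda>x. K t (fst x) (snd x))"
  shows "continuous_on S (Phi_fun T K)"
  unfolding Phi_fun_def
proof (intro continuous_on_sum)
  fix t assume "t \<in> {1..T}"
  then show "continuous_on S (\<lambda>u. K t (fst u t) (snd u t))"
    using continuous_on_compose2[OF C1_continuous[OF assms[of t]], of S "\<lambda>u. (fst u t, snd u t)"]
    by (simp add: continuous_on_Pair continuous_seq_coordinates)
qed

text \<open>Far out \<open>f\<close> dominates the sum of the \<open>l\<close>-th powers, and
  \<open>y \<le> 1 + y powr l\<close> makes this linear; on the remaining compact set the difference
  is bounded.\<close>

lemma superlinear_imp_coercive:
  fixes f :: "'a::euclidean_space \<times> 'b::euclidean_space \<Rightarrow> real"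
  assumes cont: "continuous_on UNIV f" and l: "1 \<le> l"
    and lim: "filterlim (\<lambda>x. f x / (norm (fst x) powr l + norm (snd x) powr l)) at_top
            (filtercomap (\<lambda>x. norm (fst x) + norm (snd x)) at_top)"
  shows "\<exists>B. \<forall>x. norm (fst x) + norm (snd x) - B \<le> f x"
proof -
  have "\<forall>\<^sub>F x in filtercomap (\<lambda>x. norm (fst x) + norm (snd x)) at_top.
      1 \<le> f x / (norm (fst x) powr l + norm (snd x) powr l)"
    using lim by (simp add: filterlim_at_top)
  then obtain k where k: "\<And>x. k \<le> norm (fst x) + norm (snd x) \<Longrightarrow>
      1 \<le> f x / (norm (fst x) powr l + norm (snd x) powr l)"
    unfolding eventually_filtercomap_at_top_linorder by blast
  have powr: "y \<le> 1 + y powr l" if "0 \<le> y" for y :: real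
    using powr_mono[OF l, of y] that by (cases "1 \<le> y") (auto simp: add_increasing2)
  have far: "norm (fst x) + norm (snd x) - 2 \<le> f x" if "k \<le> norm (fst x) + norm (snd x)" for x
  proof -
    \<comment> \<open>A zero denominator would make the quotient 0 by convention, against the lower
      bound 1.\<close>
    have "0 < norm (fst x) powr l + norm (snd x) powr l"
      using k[OF that] by (metis add_nonneg_nonneg div_by_0 not_one_le_zero order_le_less powr_ge_zero)
    then have "norm (fst x) powr l + norm (snd x) powr l \<le> f x"
      using k[OF that] by (simp add: pos_le_divide_eq)
    then show ?thesis using powr[of "norm (fst x)"] powr[of "norm (snd x)"] by simp
  qed
  let ?C = "{x :: 'a \<times> 'b. norm (fst x) + norm (snd x) \<le> k}"
  have "bounded ?C"
    by (rule boundedI[of _ k]) (metis (mono_tags, lifting) mem_Collect_eq norm_Pair_le order_trans prod.collapse)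
  moreover have "closed ?C" by (intro closed_Collect_le continuous_intros)
  ultimately have "compact ?C" by (simp add: compact_eq_bounded_closed)
  then have "compact ((\<lambda>x. f x - (norm (fst x) + norm (snd x))) ` ?C)"
    by (intro compact_continuous_image continuous_intros continuous_on_subset[OF cont]) auto
  then obtain B where B: "\<And>x. x \<in> ?C \<Longrightarrow> \<bar>f x - (norm (fst x) + norm (snd x))\<bar> \<le> B"
    unfolding bounded_iff using compact_imp_bounded bounded_iff by (metis (no_types, lifting) image_eqI real_norm_def)
  show ?thesis
  proof (intro exI allI)
    fix x
    show "norm (fst x) + norm (snd x) - max 2 B \<le> f x"
      using far[of x] B[of x] by (cases "norm (fst x) + norm (snd x) \<le> k") (auto simp: abs_le_iff)
  qed
qed

lemma Phi_fun_coercive: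
  assumes "\<And>t. t \<in> {1..T} \<Longrightarrow> \<exists>B. \<forall>x1 x2. norm x1 + norm x2 - B \<le> K t x1 x2"
  shows "\<exists>B. \<forall>u. sum_norm_pair T u - B \<le> Phi_fun T K u"
proof -
  obtain B where B: "\<And>t x1 x2. t \<in> {1..T} \<Longrightarrow> norm x1 + norm x2 - B t \<le> K t x1 x2"
    using assms by metis
  have "sum_norm_pair T u - (\<Sum>t\<in>{1..T}. B t) \<le> Phi_fun T K u" for u
    unfolding sum_norm_pair_def Phi_fun_def sum_subtractf[symmetric] using B by (intro sum_mono) auto
  then show ?thesis by blast
qed

subsection \<open>Reading off the hypotheses on \<open>\<mu>\<close> and \<open>\<lambda>\<close>\<close>

text \<open>\<open>L\<close> is \<open>\<mu>\<close> times the infimum of \<open>I\<close> on the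
  level, plus \<open>gamma_inf\<close>, minus \<open>r\<close>. It bounds the functional below on
  the level because \<open>Psi u \<ge> gamma_inf - r\<close> there, and clearing the positive
  denominator of a quotient below \<open>\<mu>\<close> puts \<open>v\<close> beneath it. The bound
  \<open>g\<close> and the point \<open>w\<close> make both infima finite.\<close>

lemma mu_star_witness:
  fixes I Psi Q :: "'a \<Rightarrow> real"
  assumes I: "\<And>u. u \<in> X \<Longrightarrow> 0 \<le> I u" and g: "\<And>u. u \<in> X \<Longrightarrow> g \<le> Psi u + Q u"
    and level: "w \<in> X" "Q w = r" and mu: "0 \<le> \<mu>" "mu_star X I Psi Q r < ereal \<mu>"
  obtains v L where "v \<in> X" "Q v < r" "\<mu> * I v + Psi v < L"
    "\<And>u. u \<in> X \<Longrightarrow> Q u = r \<Longrightarrow> L \<le> \<mu> * I u + Psi u"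
proof -
  have "0 \<le> eta X I Q r" unfolding eta_def using I by (intro INF_greatest) auto
  moreover have "eta X I Q r \<le> ereal (I w)" unfolding eta_def using level by (intro INF_lower) auto
  ultimately obtain e where e: "eta X I Q r = ereal e" by (cases "eta X I Q r") auto
  have "ereal g \<le> gamma_inf X Psi Q" unfolding gamma_inf_def using g by (intro INF_greatest) auto
  moreover have "gamma_inf X Psi Q \<le> ereal (Psi w + Q w)"
    unfolding gamma_inf_def using level by (intro INF_lower) auto
  ultimately obtain g' where g': "gamma_inf X Psi Q = ereal g'" by (cases "gamma_inf X Psi Q") auto
  obtain v where v: "v \<in> X" "Q v < r" "I v < e"
    "(ereal (Psi v) - ereal g' + ereal r) / (ereal e - ereal (I v)) < ereal \<mu>"
    using mu(2) unfolding mu_star_def e g' INF_less_iff by auto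
  then have "(Psi v - g' + r) / (e - I v) < \<mu>" by simp
  then have "\<mu> * I v + Psi v < \<mu> * e + g' - r" using v(3) by (simp add: divide_less_eq algebra_simps)
  moreover have "\<mu> * e + g' - r \<le> \<mu> * I u + Psi u" if "u \<in> X" "Q u = r" for u
  proof -
    have "ereal e \<le> ereal (I u)" unfolding e[symmetric] eta_def using that by (intro INF_lower) auto
    then have "\<mu> * e \<le> \<mu> * I u" using mu(1) by (simp add: mult_left_mono)
    moreover have "ereal g' \<le> ereal (Psi u + Q u)"
      unfolding g'[symmetric] gamma_inf_def using that by (intro INF_lower) auto
    ultimately show ?thesis using that(2) by simp
  qed
  ultimately show thesis using that v by blast
qed

text \<open>Some quotient exceeds \<open>lam\<close>. Its denominator \<open>r - Q v\<close> is
  negative, so clearing it reverses the inequality and gives the bound at \<open>v\<close>.\<close>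

lemma beta_sup_witness:
  fixes J Q :: "'a \<Rightarrow> real"
  assumes g: "\<And>u. u \<in> X \<Longrightarrow> Q u \<le> r \<Longrightarrow> g \<le> J u"
    and ne: "w \<in> X" "Q w \<le> r" and lam: "ereal lam < beta_sup X J Q r"
  obtains v j where "v \<in> X" "r < Q v" "J v + lam * Q v < j + lam * r"
    "\<And>u. u \<in> X \<Longrightarrow> Q u \<le> r \<Longrightarrow> j \<le> J u"
proof -
  let ?j = "INF v\<in>{v\<in>X. Q v \<le> r}. ereal (J v)"
  have "ereal g \<le> ?j" using g by (intro INF_greatest) auto
  moreover have "?j \<le> ereal (J w)" using ne by (intro INF_lower) auto
  ultimately obtain j where j: "?j = ereal j" by (cases ?j) auto
  obtain v where v: "v \<in> X" "r < Q v" "ereal lam < (ereal (J v) - ereal j) / ereal (r - Q v)"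
    using lam unfolding beta_sup_def j less_SUP_iff by auto
  then have "lam < (J v - j) / (r - Q v)" by simp
  then have "J v + lam * Q v < j + lam * r" using v(2) by (simp add: less_divide_eq algebra_simps)
  moreover have "j \<le> J u" if "u \<in> X" "Q u \<le> r" for u
  proof -
    have "ereal j \<le> ereal (J u)" unfolding j[symmetric] using that by (intro INF_lower) auto
    then show ?thesis by simp
  qed
  ultimately show thesis using that v by blast
qed

lemma I_fun_nonneg:
  assumes "\<And>i s. i \<in> {1..4} \<Longrightarrow> 0 \<le> \<rho> i s" "\<And>i x. i \<in> {1..4} \<Longrightarrow> 0 \<le> \<Phi> i x"
  shows "0 \<le> I_fun T \<rho> \<Phi> u"
  unfolding I_fun_def using assms by (intro sum_nonneg add_nonneg_nonneg mult_nonneg_nonneg) auto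

lemma bounded_abs_on_compact:
  fixes h :: "'a::topological_space \<Rightarrow> real"
  assumes "compact C" "continuous_on C h"
  obtains B where "0 \<le> B" "\<And>u. u \<in> C \<Longrightarrow> \<bar>h u\<bar> \<le> B"
proof -
  have "bounded (h ` C)" using assms by (intro compact_imp_bounded compact_continuous_image)
  then obtain B where "\<forall>y\<in>h ` C. norm y \<le> B" by (auto simp: bounded_iff)
  then show thesis by (intro that[of "\<bar>B\<bar>"]) force+
qed

section \<open>Three periodic solutions with uniformly bounded norms\<close>

theorem theorem1p1:
  fixes T :: int
    and \<rho> :: "nat \<Rightarrow> real \<Rightarrow> real"
    and \<phi> :: "nat \<Rightarrow> real ^ 'n \<Rightarrow> real ^ 'n"
    and \<Phi> :: "nat \<Rightarrow> real ^ 'n \<Rightarrow> real"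
    and F G H :: "int \<Rightarrow> real ^ 'n \<Rightarrow> real ^ 'n \<Rightarrow> real"
    and c d m :: "nat \<Rightarrow> real"
    and \<theta> l :: real
  assumes T: "T > 1"
    and rho_nonneg: "\<forall>i\<in>{1..4}. \<forall>s. \<rho> i s \<ge> 0"
    and rho_periodic: "\<forall>i\<in>{1..4}. \<forall>s. \<rho> i (s + real_of_int T) = \<rho> i s"
    and rho_min: "\<forall>i\<in>{1..4}. Min ((\<lambda>t. \<rho> i (real_of_int t)) ` {1..T}) > 0"
    and A1_homeo: "\<forall>i\<in>{1..4}. (\<exists>g. homeomorphism UNIV UNIV (\<phi> i) g) \<and> \<phi> i 0 = 0"
    and A1_potential: "\<forall>i\<in>{1..4}. C1 (\<Phi> i) \<and> \<phi> i = gradient (\<Phi> i) \<and>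
          (\<forall>x. \<Phi> i x \<ge> 0) \<and> strictly_convex (\<Phi> i) \<and> \<Phi> i 0 = 0"
    and A2_periodic: "\<forall>K\<in>{F, G, H}. \<forall>t x1 x2. K (t + T) x1 x2 = K t x1 x2"
    and A2_C1: "\<forall>K\<in>{F, G, H}. \<forall>t\<in>{1..T}. C1 (\<lambda>x. K t (fst x) (snd x))"
    and A3_const: "\<forall>i\<in>{1..4}. c i > 0" "\<theta> > 1"
    and A3: "\<forall>i\<in>{1..4}. \<forall>x y. (\<phi> i x - \<phi> i y) \<bullet> (x - y) \<ge> c i * norm (x - y) powr \<theta>"
    and A4_lim: "\<forall>i\<in>{1..4}. filterlim (\<Phi> i) at_top at_infinity"
    and A4_const: "l \<ge> \<theta>" "\<forall>i\<in>{1..4}. d i > 0 \<and> m i > 0"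
    and A4: "\<forall>i\<in>{1..4}. \<forall>x. \<Phi> i x \<le> d i * norm x powr l + m i"
    and A5_lim: "\<forall>t\<in>{1..T}.
          filterlim (\<lambda>x. F t (fst x) (snd x) / (norm (fst x) powr l + norm (snd x) powr l)) at_top
            (filtercomap (\<lambda>x. norm (fst x) + norm (snd x)) at_top)"
    and A5: "\<forall>t\<in>{1..T}. \<forall>lam>0. \<exists>C0. \<forall>x1 x2. lam * G t x1 x2 \<ge> F t x1 x2 + C0"
    and A6: "(\<Sum>t\<in>{1..T}. G t 0 0) = 0"
  shows "\<forall>r>0. \<forall>\<mu>::real.
    max 0 (mu_star (E_pair T) (I_fun T \<rho> \<Phi>) (Psi_fun T F) (Phi_fun T G) r) < ereal \<mu> \<longrightarrow>
    (\<forall>a b. a \<le> b \<and>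
        {a..b} \<subseteq> {x. 0 < x \<and> ereal x <
          beta_sup (E_pair T) (\<lambda>u. \<mu> * I_fun T \<rho> \<Phi> u + Psi_fun T F u) (Phi_fun T G) r} \<longrightarrow>
      (\<exists>R>0. \<forall>lam\<in>{a..b}. \<exists>\<delta>>0. \<forall>\<nu>\<in>{0..\<delta>}.
        \<exists>S \<subseteq> {u \<in> E_pair T. solves_system \<rho> \<phi> (W_fun F G H lam \<nu>) \<mu> u \<and> norm_pair T \<theta> u < R}.
          card S = 3))"
proof (intro allI impI, elim conjE)
  fix r \<mu> a b :: real
  define X where "X = (E_pair T :: 'n seq_pair set)"
  define J where "J = (\<lambda>u :: 'n seq_pair. \<mu> * I_fun T \<rho> \<Phi> u + Psi_fun T F u)"
  define Q where "Q = (Phi_fun T G :: 'n seq_pair \<Rightarrow> real)"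
  define h where "h = (Phi_fun T H :: 'n seq_pair \<Rightarrow> real)"
  define N where "N = (sum_norm_pair T :: 'n seq_pair \<Rightarrow> real)"
  assume r: "r > 0"
    and "max 0 (mu_star (E_pair T) (I_fun T \<rho> \<Phi>) (Psi_fun T F) (Phi_fun T G) r) < ereal \<mu>"
    and ab: "a \<le> b" and sub: "{a..b} \<subseteq> {x. 0 < x \<and> ereal x <
      beta_sup (E_pair T) (\<lambda>u. \<mu> * I_fun T \<rho> \<Phi> u + Psi_fun T F u) (Phi_fun T G) r}"
  then have mu: "0 < \<mu>" and mustar: "mu_star X (I_fun T \<rho> \<Phi>) (Psi_fun T F) Q r < ereal \<mu>"
    by (auto simp: X_def Q_def)
  have a: "0 < a" and beta: "ereal b < beta_sup X J Q r"
    using sub ab by (auto simp: X_def J_def Q_def)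
  have C1: "C1 (\<lambda>x. F t (fst x) (snd x))" "C1 (\<lambda>x. G t (fst x) (snd x))" "C1 (\<lambda>x. H t (fst x) (snd x))"
    and per: "F (t + T) = F t" "G (t + T) = G t" "H (t + T) = H t" for t
  proof -
    show per: "F (t + T) = F t" "G (t + T) = G t" "H (t + T) = H t" for t
      using A2_periodic by (auto simp: fun_eq_iff)
    \<comment> \<open>Regularity is assumed on one period only; each \<open>t\<close> is replaced by
      its representative there.\<close>
    have t: "1 + (t - 1) mod T \<in> {1..T}" using T by (intro mod_in_period) auto
    show "C1 (\<lambda>x. F t (fst x) (snd x))" "C1 (\<lambda>x. G t (fst x) (snd x))" "C1 (\<lambda>x. H t (fst x) (snd x))"
      unfolding periodic_mod[of F T t, OF per(1)] periodic_mod[of G T t, OF per(2)]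
        periodic_mod[of H T t, OF per(3)]
      using A2_C1 t by auto
  qed
  have system: "periodic_system T \<rho> \<phi> \<Phi> (W_fun F G H lam \<nu>)" for lam \<nu>
  proof
    show "1 \<le> T" using T by simp
    show "W_fun F G H lam \<nu> (t + T) = W_fun F G H lam \<nu> t" for t
      by (simp add: W_fun_def per fun_eq_iff)
    show "C1 (\<lambda>x. W_fun F G H lam \<nu> t (fst x) (snd x))" for t
      unfolding W_fun_def by (rule C1_linear_combination[OF C1])
  qed (use rho_periodic A1_potential in auto)
  have action_eq: "periodic_system.action T \<rho> \<Phi> (W_fun F G H lam \<nu>) \<mu> u = J u + lam * Q u - \<nu> * h u"
    for lam \<nu> u
    unfolding periodic_system.action_def[OF system] J_def Q_def h_def Phi_fun_def Psi_fun_def W_fun_def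
    by (simp add: sum.distrib sum_subtractf sum_distrib_left)
  \<comment> \<open>\<open>J\<close> is the action for \<open>lam = 0\<close> and
    \<open>\<nu> = 0\<close>.\<close>
  have cont_J: "continuous_on S J" for S
    using periodic_system.continuous_action[OF system, of 0 0 \<mu>] action_eq[of 0 0]
    by (auto intro: continuous_on_subset)
  have cont_Q: "continuous_on S Q" and cont_h: "continuous_on S h" for S
    unfolding Q_def h_def using C1 by (auto intro: continuous_Phi_fun)
  have cont_N: "continuous_on S N" for S unfolding N_def by (rule continuous_sum_norm_pair)
  have compact: "compact {u \<in> X. N u \<le> R}" for R
    unfolding X_def N_def using T by (intro compact_sum_norm_pair_le) auto

  have I_nonneg: "0 \<le> I_fun T \<rho> \<Phi> u" for u
    using rho_nonneg A1_potential by (intro I_fun_nonneg) auto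
  have F_coercive: "\<exists>B. \<forall>x1 x2. norm x1 + norm x2 - B \<le> F t x1 x2" if "t \<in> {1..T}" for t
    using superlinear_imp_coercive[OF C1_continuous[OF C1(1)], of l t] A5_lim A4_const(1) A3_const(2) that
    by auto
  have G_F: "\<exists>B. \<forall>x1 x2. norm x1 + norm x2 - B \<le> lam * G t x1 x2 - k * F t x1 x2"
    if tlk: "t \<in> {1..T}" "0 < lam" "0 \<le> k" for t lam k
  proof -
    obtain B where B: "\<And>x1 x2. norm x1 + norm x2 - B \<le> F t x1 x2" using F_coercive[OF tlk(1)] by blast
    \<comment> \<open>(A5) is used with the smaller constant \<open>lam / (k + 1)\<close>.
      Multiplying back leaves one extra copy of \<open>F\<close>, whose coercivity gives the linear
      lower bound.\<close>
    obtain C where C: "\<And>x1 x2. F t x1 x2 + C \<le> lam / (k + 1) * G t x1 x2"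
      using A5 tlk by (metis add_nonneg_pos divide_pos_pos zero_less_one)
    have "norm x1 + norm x2 - (B - (k + 1) * C) \<le> lam * G t x1 x2 - k * F t x1 x2" for x1 x2
    proof -
      have "(k + 1) * (F t x1 x2 + C) \<le> (k + 1) * (lam / (k + 1) * G t x1 x2)"
        using C tlk by (intro mult_left_mono) auto
      also have "\<dots> = lam * G t x1 x2" using tlk(3) by simp
      finally show ?thesis using B[of x1 x2] by (simp add: algebra_simps)
    qed
    then show ?thesis by blast
  qed
  have J_coercive: "\<exists>B. \<forall>u. N u - B \<le> J u + lam * Q u" if lam: "0 < lam" for lam
  proof -
    have "\<exists>B. \<forall>u. N u - B \<le> Phi_fun T (\<lambda>t x1 x2. lam * G t x1 x2 - 1 * F t x1 x2) u"
      unfolding N_def using lam by (intro Phi_fun_coercive G_F) auto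
    then obtain B where B: "\<And>u. N u - B \<le> Phi_fun T (\<lambda>t x1 x2. lam * G t x1 x2 - 1 * F t x1 x2) u"
      by blast
    have "Phi_fun T (\<lambda>t x1 x2. lam * G t x1 x2 - 1 * F t x1 x2) u = Psi_fun T F u + lam * Q u" for u
      by (simp add: Phi_fun_def Psi_fun_def Q_def sum_subtractf sum_distrib_left)
    then have "N u - B \<le> J u + lam * Q u" for u
      using B[of u] mult_nonneg_nonneg[OF less_imp_le[OF mu] I_nonneg[of u]] by (simp add: J_def)
    then show ?thesis by blast
  qed
  obtain Ba Bb where Bab: "\<And>u. N u - Ba \<le> J u + a * Q u" "\<And>u. N u - Bb \<le> J u + b * Q u"
    using J_coercive a ab by (metis less_le_trans)
  define B where "B = max Ba Bb"
  \<comment> \<open>The expression is affine in \<open>lam\<close>, so the bounds at the two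
    endpoints cover the interval; the sign of \<open>Q u\<close> selects the endpoint.\<close>
  have B: "N u - B \<le> J u + lam * Q u" if "lam \<in> {a..b}" for u lam
  proof (cases "0 \<le> Q u")
    case True
    then have "a * Q u \<le> lam * Q u" using that by (intro mult_right_mono) auto
    then show ?thesis using Bab(1)[of u] by (simp add: B_def)
  next
    case False
    then have "b * Q u \<le> lam * Q u" using that by (intro mult_right_mono_neg) auto
    then show ?thesis using Bab(2)[of u] by (simp add: B_def)
  qed
  have N_nonneg: "0 \<le> N u" for u by (auto simp: N_def sum_norm_pair_def intro!: sum_nonneg)

  define o' where "o' = ((\<lambda>t. 0, \<lambda>t. 0) :: 'n seq_pair)"
  have o': "o' \<in> X" "Q o' = 0"
    using A6 by (auto simp: o'_def X_def E_pair_def E_per_def Q_def Phi_fun_def)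
  have "\<exists>B. \<forall>u. N u - B \<le> Phi_fun T (\<lambda>t x1 x2. 1 * G t x1 x2 - 1 * F t x1 x2) u"
    unfolding N_def by (intro Phi_fun_coercive G_F) auto
  then obtain B1 where B1: "\<And>u. N u - B1 \<le> Phi_fun T (\<lambda>t x1 x2. 1 * G t x1 x2 - 1 * F t x1 x2) u"
    by blast
  have low: "- B1 \<le> Psi_fun T F u + Q u" for u
    using B1[of u] N_nonneg[of u] by (simp add: Phi_fun_def Psi_fun_def Q_def sum_subtractf)
  have "- B1 - r \<le> J u" if "Q u \<le> r" for u
    using low[of u] that mult_nonneg_nonneg[OF less_imp_le[OF mu] I_nonneg[of u]] unfolding J_def by linarith
  then obtain w j where w: "w \<in> X" "r < Q w" "J w + b * Q w < j + b * r"
    and j: "\<And>u. u \<in> X \<Longrightarrow> Q u \<le> r \<Longrightarrow> j \<le> J u"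
    using beta_sup_witness[of X Q r "- B1 - r" J o' b] o' r beta by (metis less_imp_le)
  \<comment> \<open>The level \<open>Q u = r\<close> must be nonempty for its infimum to be finite.
    A segment from the zero pair, where \<open>Q\<close> vanishes by (A6), to \<open>w\<close> meets
    it.\<close>
  obtain S where S: "connected S" "S \<subseteq> X" "o' \<in> S" "w \<in> S"
    using connected_sum_norm_pair_le[of o' T w "max (N o') (N w)"] o'(1) w(1)
    unfolding X_def N_def by auto
  have "connected (Q ` S)" by (intro connected_continuous_image cont_Q S)
  then have "r \<in> Q ` S" using connectedD_interval[of "Q ` S" 0 "Q w" r] S o' w r by force
  then obtain y where y: "y \<in> X" "Q y = r" using S(2) by auto
  obtain v L where v: "v \<in> X" "Q v < r" "J v < L" and L: "\<And>u. u \<in> X \<Longrightarrow> Q u = r \<Longrightarrow> L \<le> J u"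
    using mu_star_witness[of X "I_fun T \<rho> \<Phi>" "- B1" "Psi_fun T F" Q y r \<mu>] I_nonneg low y mu mustar
    unfolding J_def by (metis less_imp_le)

  \<comment> \<open>Barrier height: on \<open>Q u = r\<close> both \<open>L\<close> and
    \<open>j\<close> bound \<open>J\<close> below, and \<open>lam * Q u\<close> equals
    \<open>lam * r\<close>.\<close>
  define e where "e lam = max L j + lam * r" for lam
  have e_le: "e lam \<le> e b" if "lam \<in> {a..b}" for lam
    using that r by (simp add: e_def mult_right_mono)
  \<comment> \<open>By coercivity, any point with \<open>J u + lam * Q u \<le> e lam + 1\<close>
    lies in this ball, for every \<open>lam\<close> in \<open>{a..b}\<close>.\<close>
  define R0 where "R0 = e b + B + 1"
  obtain CJ where CJ: "0 \<le> CJ" "\<And>u. u \<in> {u \<in> X. N u \<le> R0} \<Longrightarrow> \<bar>J u\<bar> \<le> CJ"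
    using bounded_abs_on_compact[OF compact cont_J] by blast
  obtain CQ where CQ: "0 \<le> CQ" "\<And>u. u \<in> {u \<in> X. N u \<le> R0} \<Longrightarrow> \<bar>Q u\<bar> \<le> CQ"
    using bounded_abs_on_compact[OF compact cont_Q] by blast
  \<comment> \<open>On the inner ball \<open>J u + lam * Q u \<le> M - 1\<close>, and on the sphere
    of radius \<open>R\<close> it is at least \<open>M + 1\<close>. A perturbation smaller than
    \<open>1 / 2\<close> preserves this separation. All these constants are chosen before
    \<open>lam\<close> and \<open>\<nu>\<close>.\<close>
  define M where "M = CJ + b * CQ + 1"
  define R where "R = max R0 (M + B + 1)"
  obtain Ch where Ch: "0 \<le> Ch" "\<And>u. u \<in> {u \<in> X. N u \<le> R} \<Longrightarrow> \<bar>h u\<bar> \<le> Ch"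
    using bounded_abs_on_compact[OF compact cont_h] by blast
  obtain Cn where Cn: "0 \<le> Cn" "\<And>u. u \<in> {u \<in> X. N u \<le> R} \<Longrightarrow> \<bar>norm_pair T \<theta> u\<bar> \<le> Cn"
    using bounded_abs_on_compact[OF compact continuous_norm_pair[OF A3_const(2)]] by blast
  show "\<exists>R>0. \<forall>lam\<in>{a..b}. \<exists>\<delta>>0. \<forall>\<nu>\<in>{0..\<delta>}.
        \<exists>S \<subseteq> {u \<in> E_pair T. solves_system \<rho> \<phi> (W_fun F G H lam \<nu>) \<mu> u \<and> norm_pair T \<theta> u < R}.
          card S = 3"
  proof (rule exI[of _ "Cn + 1"], intro conjI ballI)
    show "0 < Cn + 1" using Cn by simp
    fix lam assume lam: "lam \<in> {a..b}"
    \<comment> \<open>At most a third of the gap between the barrier and the larger value at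
      \<open>v\<close> and \<open>w\<close>, and at most \<open>1 / 3\<close>. With perturbation
      error \<open>k\<close>, the barrier stays at least \<open>e lam - k\<close>, while both values
      are at most \<open>e lam - 2 * k\<close>.\<close>
    define k where "k = min 1 (e lam - max (J v + lam * Q v) (J w + lam * Q w)) / 3"
    have v_lt: "J v + lam * Q v < e lam"
    proof -
      have "lam * Q v < lam * r" using lam a v(2) by simp
      then show ?thesis using v(3) by (simp add: e_def)
    qed
    \<comment> \<open>The inequality at \<open>b\<close> passes to smaller \<open>lam\<close>
      because \<open>Q w - r\<close> is positive, so one \<open>w\<close> works on the whole
      interval.\<close>
    have w_lt: "J w + lam * Q w < e lam"
    proof -
      have "lam * (Q w - r) \<le> b * (Q w - r)" using lam w(2) by (intro mult_right_mono) auto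
      then show ?thesis using w(3) by (simp add: e_def algebra_simps)
    qed
    have k: "0 < k" "k < 1 / 2" "J v + lam * Q v \<le> e lam - 3 * k" "J w + lam * Q w \<le> e lam - 3 * k"
      using v_lt w_lt by (auto simp: k_def min_def max_def field_simps)
    show "\<exists>\<delta>>0. \<forall>\<nu>\<in>{0..\<delta>}.
        \<exists>S \<subseteq> {u \<in> E_pair T. solves_system \<rho> \<phi> (W_fun F G H lam \<nu>) \<mu> u \<and> norm_pair T \<theta> u < Cn + 1}.
          card S = 3"
    \<comment> \<open>This size makes \<open>\<nu> * h u\<close> at most \<open>k\<close> in
      absolute value on the large ball; adding 1 covers the case \<open>Ch = 0\<close>.\<close>
    proof (rule exI[of _ "k / (Ch + 1)"], intro conjI ballI)
      show "0 < k / (Ch + 1)" using k Ch by simp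
      fix \<nu> assume nu: "\<nu> \<in> {0..k / (Ch + 1)}"
      interpret periodic_system T \<rho> \<phi> \<Phi> "W_fun F G H lam \<nu>" \<mu> by (rule system)
      have pert: "\<bar>action u - (J u + lam * Q u)\<bar> \<le> k" if "u \<in> X" "N u \<le> R" for u
      proof -
        have "\<bar>\<nu> * h u\<bar> \<le> k / (Ch + 1) * Ch"
          using nu Ch(2)[of u] that Ch(1) unfolding abs_mult by (intro mult_mono) auto
        also have "\<dots> \<le> k" using Ch(1) k(1) by (simp add: field_simps)
        finally show ?thesis by (simp add: action_eq)
      qed
      have in_R0: "N u \<le> R0" if "u \<in> X" "J u + lam * Q u \<le> e lam + k" for u
        using B[OF lam, of u] that e_le[OF lam] k by (simp add: R0_def)
      have R0: "R0 \<le> R" by (simp add: R_def)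
      have vw: "N v \<le> R" "N w \<le> R" using in_R0[of v] in_R0[of w] v(1) w(1) v_lt w_lt k R0 by auto
      have "\<exists>S \<subseteq> {u \<in> E_pair T. N u < R \<and> slope u 0 = 0}. card S = 3"
      proof (rule three_critical_points[where Q = Q and r = r and v = v and w = w and R' = R0
            and M = M and b = "e lam - k" and z = "M - 1 + k"])
        show "continuous_on (E_pair T) N" "continuous_on (E_pair T) Q" by (rule cont_N cont_Q)+
        show "compact {u \<in> E_pair T. N u \<le> R}" using compact by (simp add: X_def)
        show "M < action u" if "u \<in> E_pair T" "N u = R" for u
          using pert[of u] B[OF lam, of u] that k unfolding X_def R_def by (auto simp: abs_le_iff)
        show "N u \<le> R0" if "u \<in> E_pair T" "N u \<le> R" "action u < e lam - k" for u
          using pert[of u] that k by (intro in_R0) (auto simp: X_def abs_le_iff)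
        show "action u \<le> M - 1 + k" if "u \<in> E_pair T" "N u \<le> R0" for u
        proof -
          have "\<bar>J u\<bar> \<le> CJ" "\<bar>Q u\<bar> \<le> CQ" using CJ CQ that by (auto simp: X_def)
          moreover have "lam * Q u \<le> b * CQ"
            using lam a \<open>\<bar>Q u\<bar> \<le> CQ\<close> CQ(1)
            by (intro order_trans[OF mult_left_mono[of "Q u" CQ lam] mult_right_mono[of lam b CQ]]) auto
          ultimately show ?thesis
            using pert[of u] that R0 by (auto simp: X_def M_def abs_le_iff)
        qed
        show "\<exists>S. connected S \<and> S \<subseteq> {u \<in> E_pair T. N u \<le> R0} \<and> p \<in> S \<and> q \<in> S"
          if "p \<in> E_pair T" "q \<in> E_pair T" "N p \<le> R0" "N q \<le> R0" for p q
          using connected_sum_norm_pair_le that unfolding N_def by blast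
        show "e lam - k \<le> action u" if "u \<in> E_pair T" "N u \<le> R" "Q u = r" for u
          using pert[of u] L[of u] j[of u] that by (auto simp: X_def e_def abs_le_iff)
        show "action v < e lam - k" "action w < e lam - k"
          using pert[of v] pert[of w] v(1) w(1) vw k by (auto simp: abs_le_iff)
        show "R0 \<le> R" "M - 1 + k < M" "v \<in> E_pair T" "N v \<le> R" "Q v < r"
          "w \<in> E_pair T" "N w \<le> R" "r < Q w"
          using R0 k v w vw by (auto simp: X_def)
      qed
      then obtain S where S: "S \<subseteq> {u \<in> E_pair T. N u < R \<and> slope u 0 = 0}" "card S = 3" by blast
      have "S \<subseteq> {u \<in> E_pair T. solves_system \<rho> \<phi> (W_fun F G H lam \<nu>) \<mu> u \<and> norm_pair T \<theta> u < Cn + 1}"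
      proof
        fix u assume "u \<in> S"
        then have u: "u \<in> E_pair T" "N u < R" "slope u 0 = 0" using S by auto
        then have "solves_system \<rho> \<phi> (W_fun F G H lam \<nu>) \<mu> u"
          unfolding solves_system_iff using slope_0_eq_0 by blast
        moreover have "\<bar>norm_pair T \<theta> u\<bar> \<le> Cn" using Cn(2)[of u] u by (simp add: X_def)
        ultimately show "u \<in> {u \<in> E_pair T. solves_system \<rho> \<phi> (W_fun F G H lam \<nu>) \<mu> u
            \<and> norm_pair T \<theta> u < Cn + 1}" using u by auto
      qed
      with S(2) show "\<exists>S \<subseteq> {u \<in> E_pair T. solves_system \<rho> \<phi> (W_fun F G H lam \<nu>) \<mu> u
            \<and> norm_pair T \<theta> u < Cn + 1}. card S = 3" by blast
    qed
  qed
qed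

end
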